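(* Let $M$ and $N$ be finitary matroids on a common ground set $E$. If there exists a set $I\in\mathcal{I}(M)\cap\mathcal{I}(N)$ with $r(M/I)<r(N/I)$, then the pair $(M,N)$ is hindered, i.e. there exists an $(M,N)$-hindrance.
   Context: A finitary matroid is a matroid (possibly on an infinite ground set) in which every circuit is finite; $\mathcal{I}(M)$ denotes its independent sets, $r(M)$ its rank (the common cardinality of its bases), $M/X$ the contraction of $X$ and $M\setminus X$ the deletion of $X$, and $\mathsf{span}_M(X)$ the closure (span) of $X$ in $M$. For $X\subseteq E$, $N.X:=N/(E\setminus X)$. For an ordered pair $(M,N)$ of finitary matroids on $E$, an $(M,N)$-hindrance is a set $H\subseteq E$ that is independent but not spanning in the matroid $N.\mathsf{span}_M(H)$. The pair $(M,N)$ is hindered if an $(M,N)$-hindrance exists. *)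

theory Defs
  imports Main
begin

definition finitary_matroid :: "'a set \<Rightarrow> ('a set \<Rightarrow> bool) \<Rightarrow> bool" where
  "finitary_matroid E indep \<longleftrightarrow>
     indep {} \<and>
     (\<forall>I. indep I \<longrightarrow> I \<subseteq> E) \<and>
     (\<forall>I J. indep J \<and> I \<subseteq> J \<longrightarrow> indep I) \<and>
     (\<forall>I J. indep I \<and> indep J \<and> finite I \<and> finite J \<and> card I < card J
            \<longrightarrow> (\<exists>x\<in>J - I. indep (insert x I))) \<and>
     (\<forall>I. I \<subseteq> E \<and> (\<forall>F. F \<subseteq> I \<and> finite F \<longrightarrow> indep F) \<longrightarrow> indep I)"

definition basis_of :: "('a set \<Rightarrow> bool) \<Rightarrow> 'a set \<Rightarrow> 'a set \<Rightarrow> bool" where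
  "basis_of indep X B \<longleftrightarrow> B \<subseteq> X \<and> indep B \<and> (\<forall>x\<in>X - B. \<not> indep (insert x B))"

definition contract_indep :: "'a set \<Rightarrow> ('a set \<Rightarrow> bool) \<Rightarrow> 'a set \<Rightarrow> 'a set \<Rightarrow> bool" where
  "contract_indep E indep X J \<longleftrightarrow>
     J \<subseteq> E - X \<and> (\<exists>B. basis_of indep (X \<inter> E) B \<and> indep (J \<union> B))"

definition span :: "'a set \<Rightarrow> ('a set \<Rightarrow> bool) \<Rightarrow> 'a set \<Rightarrow> 'a set" where
  "span E indep X = X \<union> {x\<in>E. \<exists>I. I \<subseteq> X \<and> indep I \<and> \<not> indep (insert x I)}"

definition restrict_contract_indep :: "'a set \<Rightarrow> ('a set \<Rightarrow> bool) \<Rightarrow> 'a set \<Rightarrow> 'a set \<Rightarrow> bool" where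
  "restrict_contract_indep E indep X = contract_indep E indep (E - X)"

definition hindrance :: "'a set \<Rightarrow> ('a set \<Rightarrow> bool) \<Rightarrow> ('a set \<Rightarrow> bool) \<Rightarrow> 'a set \<Rightarrow> bool" where
  "hindrance E indM indN H \<longleftrightarrow>
     (let S = span E indM H; indNS = restrict_contract_indep E indN S in
        indNS H \<and> span (E \<inter> S) indNS H \<noteq> E \<inter> S)"

definition hindered :: "'a set \<Rightarrow> ('a set \<Rightarrow> bool) \<Rightarrow> ('a set \<Rightarrow> bool) \<Rightarrow> bool" where
  "hindered E indM indN \<longleftrightarrow> (\<exists>H. hindrance E indM indN H)"

text \<open>r(M) < r(N) for matroids on common ground set E (cardinal comparison of bases;
bases of a finitary matroid all have the same cardinality).\<close>
definition rank_less :: "'a set \<Rightarrow> ('a set \<Rightarrow> bool) \<Rightarrow> ('a set \<Rightarrow> bool) \<Rightarrow> bool" where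
  "rank_less E indM indN \<longleftrightarrow>
     (\<exists>B B'. basis_of indM E B \<and> basis_of indN E B' \<and> (card_of B, card_of B') \<in> ordLess)"

end

theory Submission
  imports Defs
begin

text \<open>
  Work with the closure operators of \<open>M\<close> and \<open>N\<close>. For a common independent set \<open>I\<close> let \<open>reach\<close> be
  the set of elements reachable by alternating paths from those outside the \<open>N\<close>-closure of \<open>I\<close>. If
  \<open>reach\<close> lies in the \<open>M\<close>-closure of \<open>I\<close>, then \<open>I \<inter> reach\<close> is a hindrance; otherwise a shortest
  path augments \<open>I\<close>. For finite \<open>r(M/I)\<close> finitely many augmentations suffice.

  For \<open>r(M/I) = \<kappa>\<close> infinite, consider sets \<open>W\<close> of size at most \<open>\<kappa>\<close> over which \<open>I - W\<close> is independent
  in both matroids, and let \<open>S(W)\<close> be the set reachable for \<open>I - W\<close> in \<open>(M/W, N/W)\<close>; it decreases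
  with \<open>W\<close>. A Loewenheim-Skolem argument gives a \<open>Z\<close> such that \<open>S(W) \<union> (I \<inter> S(Z))\<close> spans \<open>S(Z)\<close> in
  \<open>M\<close> for all \<open>W\<close> containing \<open>Z\<close>. Hence as long as a modification of \<open>I \<inter> S(Z)\<close> inside a small \<open>W\<close>
  does not span \<open>S(Z)\<close> in \<open>M\<close>, it can be augmented outside \<open>W\<close>, disjointly from all earlier changes.
  As \<open>S(Z)\<close> has rank at most \<open>\<kappa>\<close> over \<open>I \<inter> S(Z)\<close>, Zorn's lemma yields a small modification which spans
  \<open>S(Z)\<close> in \<open>M\<close> and is independent in \<open>N.S(Z)\<close>. It does not span \<open>N.S(Z)\<close>, because \<open>r(N/I) > \<kappa>\<close>.
\<close>

unbundle cardinal_syntax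

section \<open>Finitary closure operators with exchange\<close>

locale finitary_closure =
  fixes cl :: "'a set \<Rightarrow> 'a set"
  assumes subset_cl: "A \<subseteq> cl A"
    and cl_mono: "A \<subseteq> B \<Longrightarrow> cl A \<subseteq> cl B"
    and cl_cl: "cl (cl A) \<subseteq> cl A"
    and cl_exchange: "y \<in> cl (insert x A) \<Longrightarrow> y \<notin> cl A \<Longrightarrow> x \<in> cl (insert y A)"
    and cl_finite: "x \<in> cl A \<Longrightarrow> \<exists>F. finite F \<and> F \<subseteq> A \<and> x \<in> cl F"

definition free :: "('a set \<Rightarrow> 'a set) \<Rightarrow> 'a set \<Rightarrow> bool" where
  "free cl A \<longleftrightarrow> (\<forall>x\<in>A. x \<notin> cl (A - {x}))"

definition contract :: "('a set \<Rightarrow> 'a set) \<Rightarrow> 'a set \<Rightarrow> 'a set \<Rightarrow> 'a set" where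
  "contract cl X A = cl (X \<union> A)"

context finitary_closure
begin

lemma cl_leI: "A \<subseteq> cl B \<Longrightarrow> cl A \<subseteq> cl B"
  using cl_mono cl_cl by blast

lemma in_cl_mono: "x \<in> cl A \<Longrightarrow> A \<subseteq> B \<Longrightarrow> x \<in> cl B"
  using cl_mono by blast

lemma in_cl_trans: "x \<in> cl A \<Longrightarrow> A \<subseteq> cl B \<Longrightarrow> x \<in> cl B"
  using cl_leI by blast

lemma in_cl: "x \<in> A \<Longrightarrow> x \<in> cl A"
  using subset_cl by blast

lemma cl_insert_absorb: "x \<in> cl A \<Longrightarrow> cl (insert x A) = cl A"
  by (intro antisym cl_leI cl_mono) (use subset_cl in auto)

lemma finitary_closure_contract: "finitary_closure (contract cl X)"
proof
  fix A B :: "'a set" and x y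
  show "A \<subseteq> contract cl X A"
    using subset_cl unfolding contract_def by blast
  show "A \<subseteq> B \<Longrightarrow> contract cl X A \<subseteq> contract cl X B"
    unfolding contract_def by (intro cl_mono) blast
  show "contract cl X (contract cl X A) \<subseteq> contract cl X A"
    unfolding contract_def by (intro cl_leI) (use subset_cl in blast)
  show "y \<in> contract cl X (insert x A) \<Longrightarrow> y \<notin> contract cl X A \<Longrightarrow> x \<in> contract cl X (insert y A)"
    using cl_exchange[of y x "X \<union> A"] unfolding contract_def by simp
  assume "x \<in> contract cl X A"
  then obtain F where F: "finite F" "F \<subseteq> X \<union> A" "x \<in> cl F"
    using cl_finite[of x "X \<union> A"] unfolding contract_def by blast
  then have "x \<in> contract cl X (F - X)"
    unfolding contract_def by (elim in_cl_mono) blast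
  with F show "\<exists>F. finite F \<and> F \<subseteq> A \<and> x \<in> contract cl X F"
    by (intro exI[of _ "F - X"]) auto
qed

lemma free_subset:
  assumes "free cl A" "B \<subseteq> A"
  shows "free cl B"
  unfolding free_def
proof (intro ballI notI)
  fix x assume "x \<in> B" "x \<in> cl (B - {x})"
  then have "x \<in> cl (A - {x})"
    using assms(2) by (elim in_cl_mono) blast
  then show False using assms \<open>x \<in> B\<close> unfolding free_def by blast
qed

lemma free_empty: "free cl {}"
  by (simp add: free_def)

lemma free_finitary:
  assumes "\<And>F. finite F \<Longrightarrow> F \<subseteq> A \<Longrightarrow> free cl F"
  shows "free cl A"
  unfolding free_def
proof (intro ballI notI)
  fix x assume x: "x \<in> A" "x \<in> cl (A - {x})"
  obtain F where F: "finite F" "F \<subseteq> A - {x}" "x \<in> cl F"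
    using cl_finite[OF x(2)] by blast
  have "free cl (insert x F)" by (rule assms) (use F x in auto)
  then have "x \<notin> cl (insert x F - {x})" unfolding free_def by blast
  moreover have "F \<subseteq> insert x F - {x}" using F by blast
  ultimately show False using in_cl_mono[OF F(3)] by blast
qed

lemma free_insert:
  assumes "free cl A" "x \<notin> cl A"
  shows "free cl (insert x A)"
  unfolding free_def
proof (intro ballI notI)
  fix y assume y: "y \<in> insert x A" "y \<in> cl (insert x A - {y})"
  have "x \<notin> A" using assms in_cl by blast
  show False
  proof (cases "y = x")
    case True
    then show False using y assms \<open>x \<notin> A\<close> by simp
  next
    case False
    then have "y \<in> A" "y \<in> cl (insert x (A - {y}))"
      using y by (auto simp: insert_Diff_if)
    then have "x \<in> cl (insert y (A - {y}))"
      using cl_exchange assms unfolding free_def by blast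
    then show False using assms \<open>y \<in> A\<close> by (simp add: insert_absorb)
  qed
qed

lemma minimal_support:
  assumes "x \<in> cl (A \<union> Z)"
  obtains K where "finite K" "K \<subseteq> Z" "x \<in> cl (A \<union> K)"
    "\<And>k. k \<in> K \<Longrightarrow> x \<notin> cl (A \<union> (K - {k}))"
proof -
  interpret C: finitary_closure "contract cl A" by (rule finitary_closure_contract)
  obtain F where "finite F" "F \<subseteq> Z" "x \<in> cl (A \<union> F)"
    using C.cl_finite[of x Z] assms unfolding contract_def by blast
  let ?S = "{L. L \<subseteq> F \<and> x \<in> cl (A \<union> L)}"
  have "finite ?S" "F \<in> ?S"
    using \<open>finite F\<close> \<open>x \<in> cl (A \<union> F)\<close> by auto
  then have "\<exists>K\<in>?S. \<forall>L\<in>?S. L \<subseteq> K \<longrightarrow> K = L"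
    by (intro finite_has_minimal) auto
  then obtain K where K: "K \<in> ?S" and min: "\<forall>L\<in>?S. L \<subseteq> K \<longrightarrow> K = L"
    by (elim bexE)
  show thesis
  proof (rule that)
    show "finite K" "K \<subseteq> Z" using K \<open>finite F\<close> \<open>F \<subseteq> Z\<close> by (auto intro: finite_subset)
    fix k assume "k \<in> K"
    then show "x \<notin> cl (A \<union> (K - {k}))" using bspec[OF min, of "K - {k}"] K by auto
  qed (use K in auto)
qed

lemma minimal_support_exchange:
  assumes "x \<in> cl (A \<union> K)" "x \<notin> cl (A \<union> (K - {k}))" "k \<in> K"
  shows "k \<in> cl (insert x (A \<union> (K - {k})))"
proof -
  have "A \<union> K = insert k (A \<union> (K - {k}))" using assms by blast
  then show ?thesis using cl_exchange assms by metis
qed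

lemma minimal_support_free:
  assumes "x \<in> cl (A \<union> K)" "\<And>k. k \<in> K \<Longrightarrow> x \<notin> cl (A \<union> (K - {k}))"
  shows "free (contract cl A) K"
  unfolding free_def contract_def
proof (intro ballI notI)
  fix k assume k: "k \<in> K" "k \<in> cl (A \<union> (K - {k}))"
  have "A \<union> K \<subseteq> cl (A \<union> (K - {k}))"
    using k subset_cl[of "A \<union> (K - {k})"] by blast
  then show False using in_cl_trans[OF assms(1)] assms(2) k by blast
qed

lemma cl_Un_free:
  assumes "free (contract cl W) A" "X \<subseteq> cl W" "x \<in> cl W" "x \<in> cl (X \<union> A)"
  shows "x \<in> cl X"
proof -
  obtain K where K: "finite K" "K \<subseteq> A" "x \<in> cl (X \<union> K)"
    and min: "\<And>k. k \<in> K \<Longrightarrow> x \<notin> cl (X \<union> (K - {k}))"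
    using minimal_support assms(4) by metis
  have "K = {}"
  proof (rule ccontr)
    assume "K \<noteq> {}"
    then obtain k where k: "k \<in> K" by blast
    then have "k \<in> cl (insert x (X \<union> (K - {k})))"
      using minimal_support_exchange K min by blast
    moreover have "insert x (X \<union> (K - {k})) \<subseteq> cl (W \<union> (A - {k}))"
      using assms(2,3) cl_mono[of W "W \<union> (A - {k})"] K subset_cl[of "W \<union> (A - {k})"] by blast
    ultimately have "k \<in> cl (W \<union> (A - {k}))" by (rule in_cl_trans)
    then show False using assms(1) k K unfolding free_def contract_def by blast
  qed
  then show ?thesis using K by simp
qed

lemma free_contract_disjoint: "free (contract cl W) A \<Longrightarrow> x \<in> A \<Longrightarrow> x \<notin> cl W"
  unfolding free_def contract_def using in_cl_mono[of x W "W \<union> (A - {x})"] by blast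

lemma free_contract_antimono:
  assumes "free (contract cl X) A" "Y \<subseteq> cl X"
  shows "free (contract cl Y) A"
  unfolding free_def contract_def
proof (intro ballI notI)
  fix x assume x: "x \<in> A" "x \<in> cl (Y \<union> (A - {x}))"
  have "Y \<union> (A - {x}) \<subseteq> cl (X \<union> (A - {x}))"
    using assms(2) cl_mono[of X "X \<union> (A - {x})"] subset_cl[of "X \<union> (A - {x})"] by blast
  then show False
    using in_cl_trans[OF x(2)] assms(1) x(1) unfolding free_def contract_def by blast
qed

lemma free_Un:
  assumes "free cl A" "free (contract cl A) B"
  shows "free cl (A \<union> B)"
  unfolding free_def
proof (intro ballI notI)
  fix x assume x: "x \<in> A \<union> B" "x \<in> cl (A \<union> B - {x})"
  show False
  proof (cases "x \<in> A")
    case True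
    then have "x \<in> cl ((A - {x}) \<union> B)" using x(2) by (elim in_cl_mono) blast
    then have "x \<in> cl (A - {x})"
      using cl_Un_free[OF assms(2), of "A - {x}" x] True subset_cl by blast
    then show False using assms True unfolding free_def by blast
  next
    case False
    then have "x \<in> cl (A \<union> (B - {x}))" using x(2) by (elim in_cl_mono) blast
    then show False using assms False x unfolding free_def contract_def by blast
  qed
qed

lemma free_contractI:
  assumes "free cl (A \<union> B)" "A \<inter> B = {}"
  shows "free (contract cl A) B"
  unfolding free_def contract_def
proof (intro ballI notI)
  fix x assume x: "x \<in> B" "x \<in> cl (A \<union> (B - {x}))"
  have "A \<union> (B - {x}) \<subseteq> A \<union> B - {x}" using x assms(2) by blast
  then show False using in_cl_mono[OF x(2)] x(1) assms(1) unfolding free_def by blast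
qed

lemma cl_circuit:
  assumes "free (contract cl W) A" "x \<in> cl (W \<union> A)"
  shows "x \<in> cl (W \<union> {f \<in> A. x \<notin> cl (W \<union> (A - {f}))})"
proof -
  obtain K where K: "finite K" "K \<subseteq> A" "x \<in> cl (W \<union> K)"
    and min: "\<And>k. k \<in> K \<Longrightarrow> x \<notin> cl (W \<union> (K - {k}))"
    using minimal_support assms(2) by metis
  have "K \<subseteq> {f \<in> A. x \<notin> cl (W \<union> (A - {f}))}"
  proof
    fix k assume k: "k \<in> K"
    have "k \<in> cl (insert x (W \<union> (K - {k})))"
      using minimal_support_exchange K min k by blast
    moreover have "k \<notin> cl (W \<union> (A - {k}))"
      using assms(1) k K unfolding free_def contract_def by blast
    ultimately have "\<not> insert x (W \<union> (K - {k})) \<subseteq> cl (W \<union> (A - {k}))"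
      using in_cl_trans[of k "insert x (W \<union> (K - {k}))"] by blast
    then have "x \<notin> cl (W \<union> (A - {k}))"
      using subset_cl[of "W \<union> (A - {k})"] K by blast
    then show "k \<in> {f \<in> A. x \<notin> cl (W \<union> (A - {f}))}" using k K by blast
  qed
  then show ?thesis by (intro in_cl_mono[OF K(3)] Un_mono order_refl)
qed

lemma free_chain_Union:
  assumes "subset.chain UNIV \<C>" "\<And>A. A \<in> \<C> \<Longrightarrow> free cl A"
  shows "free cl (\<Union>\<C>)"
proof (cases "\<C> = {}")
  case False
  show ?thesis
  proof (rule free_finitary)
    fix F assume "finite F" "F \<subseteq> \<Union>\<C>"
    then obtain A where "A \<in> \<C>" "F \<subseteq> A"
      using finite_subset_Union_chain[of F \<C> UNIV] False assms(1) by blast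
    then show "free cl F" using assms(2) by (meson free_subset)
  qed
qed (simp add: free_empty)

lemma free_extends_to_basis:
  assumes "free cl A" "A \<subseteq> D"
  obtains B where "free cl B" "A \<subseteq> B" "B \<subseteq> D" "D \<subseteq> cl B"
proof -
  let ?S = "{B. free cl B \<and> A \<subseteq> B \<and> B \<subseteq> D}"
  have "\<exists>M\<in>?S. \<forall>X\<in>?S. M \<subseteq> X \<longrightarrow> X = M"
  proof (rule subset_Zorn_nonempty)
    show "?S \<noteq> {}" using assms by blast
    fix \<C> assume C: "\<C> \<noteq> {}" "subset.chain ?S \<C>"
    then have "subset.chain UNIV \<C>" by (auto simp: subset_chain_def)
    then have "free cl (\<Union>\<C>)"
      by (rule free_chain_Union) (use C in \<open>auto simp: subset_chain_def\<close>)
    then show "\<Union>\<C> \<in> ?S" using C by (auto simp: subset_chain_def)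
  qed
  then obtain B where B: "free cl B" "A \<subseteq> B" "B \<subseteq> D"
    and max: "\<forall>X\<in>?S. B \<subseteq> X \<longrightarrow> X = B"
    by (metis (no_types, lifting) mem_Collect_eq)
  have "D \<subseteq> cl B"
  proof
    fix x assume "x \<in> D"
    show "x \<in> cl B"
    proof (rule ccontr)
      assume "x \<notin> cl B"
      then have "insert x B \<in> ?S" using free_insert B \<open>x \<in> D\<close> by auto
      then have "insert x B = B" using max by blast
      then show False using \<open>x \<notin> cl B\<close> in_cl by blast
    qed
  qed
  then show thesis by (rule that[OF B])
qed

end

lemma finite_free_card_le:
  assumes "finite W" "finitary_closure cl" "finite C" "free cl C" "C \<subseteq> cl W"
  shows "card C \<le> card W"
  using assms
proof (induction W arbitrary: cl C rule: finite_induct)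
  case empty
  interpret finitary_closure cl by fact
  have "C = {}"
  proof (rule ccontr)
    assume "C \<noteq> {}"
    then obtain c where "c \<in> C" by blast
    then have "c \<in> cl (C - {c})"
      using \<open>C \<subseteq> cl {}\<close> cl_mono[of "{}" "C - {c}"] by blast
    then show False using \<open>free cl C\<close> \<open>c \<in> C\<close> unfolding free_def by blast
  qed
  then show ?case by simp
next
  case (insert w W)
  interpret finitary_closure cl by fact
  have le: "card D \<le> card W" if "D \<subseteq> C" "free (contract cl {w}) D" for D
  proof (rule insert.IH)
    show "finitary_closure (contract cl {w})" by (rule finitary_closure_contract)
    show "finite D" using \<open>finite C\<close> that(1) by (rule rev_finite_subset)
    show "D \<subseteq> contract cl {w} W"
      using \<open>C \<subseteq> cl (insert w W)\<close> that(1) unfolding contract_def by auto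
  qed (fact that(2))
  show ?case
  proof (cases "free (contract cl {w}) C")
    case True
    then show ?thesis using le[of C] insert.hyps by simp
  next
    case False
    then obtain c where c: "c \<in> C" "c \<in> cl (insert w (C - {c}))"
      unfolding free_def contract_def by auto
    have c': "c \<notin> cl (C - {c})" using \<open>free cl C\<close> c unfolding free_def by blast
    have w: "w \<notin> cl (C - {c})"
    proof
      assume "w \<in> cl (C - {c})"
      then show False using c c' by (simp add: cl_insert_absorb)
    qed
    have "free cl ({w} \<union> (C - {c}))"
      using free_insert[OF free_subset[OF \<open>free cl C\<close>] w] by simp
    moreover have "{w} \<inter> (C - {c}) = {}" using w in_cl[of w "C - {c}"] by blast
    ultimately have "card (C - {c}) \<le> card W" by (intro le free_contractI Diff_subset)
    then show ?thesis
      using insert.hyps card_Suc_Diff1[OF \<open>finite C\<close> c(1)] by simp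
  qed
qed

context finitary_closure
begin

lemma free_finite_if_span:
  assumes "finite W" "free cl C" "C \<subseteq> cl W"
  shows "finite C"
proof (rule ccontr)
  assume "infinite C"
  then obtain D where "D \<subseteq> C" "finite D" "card D = Suc (card W)"
    using infinite_arbitrarily_large by metis
  then show False
    using finite_free_card_le[OF assms(1) finitary_closure_axioms, of D]
      free_subset[OF assms(2)] assms(3) by auto
qed

end

lemma finite_ordLeq_infinite: "finite A \<Longrightarrow> infinite B \<Longrightarrow> |A| \<le>o |B|"
  by (intro ordLess_imp_ordLeq finite_ordLess_infinite) (simp_all add: card_of_well_order_on Field_card_of)

lemma card_of_Fpow_ordLeq:
  assumes "infinite B" "|A| \<le>o |B|"
  shows "|Fpow A| \<le>o |B|"
proof -
  have "|{F. F \<subseteq> A \<and> finite F \<and> card F = n}| \<le>o |B|" for n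
  proof (induction n)
    case 0
    have "finite {F. F \<subseteq> A \<and> finite F \<and> card F = 0}"
      by (rule finite_subset[of _ "{{}}"]) auto
    then show ?case
      using assms(1) finite_ordLeq_infinite by blast
  next
    case (Suc n)
    let ?P = "\<lambda>n. {F. F \<subseteq> A \<and> finite F \<and> card F = n}"
    have "?P (Suc n) \<subseteq> (\<Union>a\<in>A. insert a ` ?P n)"
    proof
      fix F assume F: "F \<in> ?P (Suc n)"
      then obtain a where "a \<in> F" by fastforce
      then have "F = insert a (F - {a})" "F - {a} \<in> ?P n" "a \<in> A" using F by auto
      then show "F \<in> (\<Union>a\<in>A. insert a ` ?P n)" by blast
    qed
    moreover have "\<forall>a\<in>A. |insert a ` ?P n| \<le>o |B|"
      by (intro ballI ordLeq_transitive[OF card_of_image Suc])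
    then have "|\<Union>a\<in>A. insert a ` ?P n| \<le>o |B|"
      by (rule card_of_UNION_ordLeq_infinite[OF assms])
    ultimately show ?case by (rule ordLeq_transitive[OF card_of_mono1])
  qed
  moreover have "|UNIV :: nat set| \<le>o |B|" using assms(1) infinite_iff_card_of_nat by blast
  ultimately have "|\<Union>n. {F. F \<subseteq> A \<and> finite F \<and> card F = n}| \<le>o |B|"
    by (intro card_of_UNION_ordLeq_infinite[OF assms(1)]) auto
  moreover have "Fpow A = (\<Union>n. {F. F \<subseteq> A \<and> finite F \<and> card F = n})"
    by (auto simp: Fpow_def)
  ultimately show ?thesis by simp
qed

context finitary_closure
begin

lemma free_card_of_le:
  assumes "free cl C" "C \<subseteq> cl W"
  shows "|C| \<le>o |W|"
proof (cases "finite W")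
  case True
  then have "finite C" using assms by (rule free_finite_if_span)
  then have "card C \<le> card W"
    using finite_free_card_le[OF True finitary_closure_axioms] assms by simp
  then show ?thesis
    using True \<open>finite C\<close> by (metis card_of_ordLeq inj_on_iff_card_le)
next
  case False
  have fin: "finite {c \<in> C. c \<in> cl F}" if "F \<in> Fpow W" for F
    using free_finite_if_span[of F "{c \<in> C. c \<in> cl F}"] free_subset[OF assms(1)] that
    by (auto simp: Fpow_def)
  have "C \<subseteq> (\<Union>F\<in>Fpow W. {c \<in> C. c \<in> cl F})"
  proof
    fix c assume "c \<in> C"
    then obtain F where "finite F" "F \<subseteq> W" "c \<in> cl F"
      using assms(2) cl_finite[of c W] by auto
    then show "c \<in> (\<Union>F\<in>Fpow W. {c \<in> C. c \<in> cl F})"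
      using \<open>c \<in> C\<close> by (auto simp: Fpow_def)
  qed
  moreover have "|\<Union>F\<in>Fpow W. {c \<in> C. c \<in> cl F}| \<le>o |W|"
  proof (rule card_of_UNION_ordLeq_infinite[OF False])
    show "|Fpow W| \<le>o |W|" by (simp add: card_of_Fpow_ordLeq False card_of_mono1)
    show "\<forall>F\<in>Fpow W. |{c \<in> C. c \<in> cl F}| \<le>o |W|"
      by (intro ballI finite_ordLeq_infinite fin False)
  qed
  ultimately show ?thesis by (rule ordLeq_transitive[OF card_of_mono1])
qed

end

section \<open>Augmenting a common free set\<close>

primrec layer ::
  "('a set \<Rightarrow> 'a set) \<Rightarrow> ('a set \<Rightarrow> 'a set) \<Rightarrow> 'a set \<Rightarrow> nat \<Rightarrow> 'a set" where
  "layer cM cN I 0 = - cN I"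
| "layer cM cN I (Suc n) =
     {e'. \<exists>e\<in>layer cM cN I n. \<exists>f\<in>I. e \<notin> cM (I - {f}) \<and> e' \<notin> cN (I - {f})}"

definition reach ::
  "('a set \<Rightarrow> 'a set) \<Rightarrow> ('a set \<Rightarrow> 'a set) \<Rightarrow> 'a set \<Rightarrow> 'a set" where
  "reach cM cN I = (\<Union>n. layer cM cN I n)"

lemma reach_source: "e \<notin> cN I \<Longrightarrow> e \<in> reach cM cN I"
  unfolding reach_def by (auto intro: exI[of _ 0])

lemma reach_step:
  assumes "e \<in> reach cM cN I" "f \<in> I" "e \<notin> cM (I - {f})" "e' \<notin> cN (I - {f})"
  shows "e' \<in> reach cM cN I"
proof -
  obtain n where "e \<in> layer cM cN I n" using assms(1) unfolding reach_def by blast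
  then have "e' \<in> layer cM cN I (Suc n)" using assms(2-4) by auto
  then show ?thesis unfolding reach_def by blast
qed

lemma reach_induct [consumes 1, case_names source step]:
  assumes "e \<in> reach cM cN I"
    and source: "\<And>e. e \<notin> cN I \<Longrightarrow> P e"
    and step: "\<And>e e' f. e \<in> reach cM cN I \<Longrightarrow> P e \<Longrightarrow> f \<in> I \<Longrightarrow> e \<notin> cM (I - {f})
      \<Longrightarrow> e' \<notin> cN (I - {f}) \<Longrightarrow> P e'"
  shows "P e"
proof -
  have "P e" if "e \<in> layer cM cN I n" for n e
    using that
  proof (induction n arbitrary: e)
    case 0
    then show ?case using source by simp
  next
    case (Suc n)
    then obtain d f where "d \<in> layer cM cN I n" "f \<in> I" "d \<notin> cM (I - {f})" "e \<notin> cN (I - {f})"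
      by auto
    then show ?case using step[of d f e] Suc.IH unfolding reach_def by blast
  qed
  then show ?thesis using assms(1) unfolding reach_def by blast
qed

definition chordless_path ::
  "('a set \<Rightarrow> 'a set) \<Rightarrow> ('a set \<Rightarrow> 'a set) \<Rightarrow> 'a set \<Rightarrow> nat \<Rightarrow> (nat \<Rightarrow> 'a) \<Rightarrow> (nat \<Rightarrow> 'a) \<Rightarrow> bool"
  where
  "chordless_path cM cN I n e f \<longleftrightarrow>
     (\<forall>i<n. f i \<in> I \<and> e i \<notin> cM (I - {f i}) \<and> e (Suc i) \<notin> cN (I - {f i})) \<and>
     (\<forall>i j. i < j \<and> j < n \<longrightarrow> e i \<in> cM (I - {f j})) \<and>
     (\<forall>i j. Suc i < j \<and> j \<le> n \<longrightarrow> e j \<in> cN (I - {f i})) \<and>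
     e 0 \<notin> cN I \<and> (\<forall>i. 0 < i \<and> i \<le> n \<longrightarrow> e i \<in> cN I) \<and>
     (\<forall>i<n. e i \<in> cM I) \<and> e n \<notin> cM I"

lemma layer_path:
  "x \<in> layer cM cN I n \<Longrightarrow> \<exists>e f. e n = x \<and> (\<forall>i\<le>n. e i \<in> layer cM cN I i) \<and>
     (\<forall>i<n. f i \<in> I \<and> e i \<notin> cM (I - {f i}) \<and> e (Suc i) \<notin> cN (I - {f i}))"
proof (induction n arbitrary: x)
  case 0
  then show ?case by (intro exI[of _ "\<lambda>_. x"]) simp
next
  case (Suc n)
  then obtain y g where y: "y \<in> layer cM cN I n" "g \<in> I" "y \<notin> cM (I - {g})" "x \<notin> cN (I - {g})"
    by auto
  obtain e f where ef: "e n = y" "\<forall>i\<le>n. e i \<in> layer cM cN I i"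
    "\<forall>i<n. f i \<in> I \<and> e i \<notin> cM (I - {f i}) \<and> e (Suc i) \<notin> cN (I - {f i})"
    using Suc.IH[OF y(1)] by blast
  have "\<forall>i\<le>Suc n. (e(Suc n := x)) i \<in> layer cM cN I i"
    using ef(2) Suc.prems by (simp add: le_Suc_eq)
  moreover have "\<forall>i<Suc n. (f(n := g)) i \<in> I \<and> (e(Suc n := x)) i \<notin> cM (I - {(f(n := g)) i}) \<and>
      (e(Suc n := x)) (Suc i) \<notin> cN (I - {(f(n := g)) i})"
    using ef y by (auto simp: less_Suc_eq)
  ultimately show ?case by (intro exI[of _ "e(Suc n := x)"] exI[of _ "f(n := g)"]) simp
qed

lemma chordless_path_exists:
  assumes "x \<in> layer cM cN I n" "x \<notin> cM I" "\<And>m. m < n \<Longrightarrow> layer cM cN I m \<subseteq> cM I"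
  shows "\<exists>e f. chordless_path cM cN I n e f"
proof -
  obtain e f where e: "e n = x" "\<And>i. i \<le> n \<Longrightarrow> e i \<in> layer cM cN I i"
    and f: "\<And>i. i < n \<Longrightarrow> f i \<in> I \<and> e i \<notin> cM (I - {f i}) \<and> e (Suc i) \<notin> cN (I - {f i})"
    using layer_path[OF assms(1)] by blast
  have not_layer: "e i \<notin> layer cM cN I m" if "m < i" "i \<le> n" for i m
  proof
    assume i: "e i \<in> layer cM cN I m"
    have "i + k \<le> n \<Longrightarrow> e (i + k) \<in> layer cM cN I (m + k)" for k
    proof (induction k)
      case 0
      then show ?case using i by simp
    next
      case (Suc k)
      then show ?case using f[of "i + k"] by auto
    qed
    from this[of "n - i"] have "x \<in> layer cM cN I (m + (n - i))" using that e by simp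
    moreover have "m + (n - i) < n" using that by simp
    ultimately show False using assms(2,3) by blast
  qed
  have "e i \<in> cM (I - {f j})" if "i < j" "j < n" for i j
  proof (rule ccontr)
    assume "e i \<notin> cM (I - {f j})"
    then have "e (Suc j) \<in> layer cM cN I (Suc i)" using f[of j] e(2)[of i] that by auto
    then show False using not_layer[of "Suc i" "Suc j"] that by simp
  qed
  moreover have "e j \<in> cN (I - {f i})" if "Suc i < j" "j \<le> n" for i j
  proof (rule ccontr)
    assume "e j \<notin> cN (I - {f i})"
    then have "e j \<in> layer cM cN I (Suc i)" using f[of i] e(2)[of i] that by auto
    then show False using not_layer[of "Suc i" j] that by simp
  qed
  moreover have "e i \<in> cN I" if "0 < i" "i \<le> n" for i
    using not_layer[of 0 i] that by simp
  moreover have "e 0 \<notin> cN I" using e(2)[of 0] by simp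
  moreover have "e i \<in> cM I" if "i < n" for i
    using e(2)[of i] assms(3) that by auto
  ultimately have "chordless_path cM cN I n e f"
    unfolding chordless_path_def using f e(1) assms(2) by auto
  then show ?thesis by blast
qed

lemma (in finitary_closure) cl_Diff_pair:
  assumes "free cl A" "x \<in> cl (A - {f})" "x \<in> cl (A - {g})"
  shows "x \<in> cl (A - {f, g})"
proof -
  have "contract cl {} = cl" by (simp add: contract_def fun_eq_iff)
  then have "x \<in> cl {h \<in> A. x \<notin> cl (A - {h})}"
    using cl_circuit[of "{}" A x] assms(1) in_cl_mono[OF assms(2), of A] by auto
  then show ?thesis by (elim in_cl_mono) (use assms(2,3) in auto)
qed

lemma (in finitary_closure) cl_swap:
  assumes "x \<in> cl A" "f \<in> A" "x \<notin> cl (A - {f})"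
  shows "cl (insert x (A - {f})) = cl A"
proof (rule antisym; rule cl_leI)
  show "insert x (A - {f}) \<subseteq> cl A" using assms(1) subset_cl[of A] by blast
  have "f \<in> cl (insert x (A - {f}))"
    using cl_exchange[of x f "A - {f}"] assms by (simp add: insert_absorb)
  then show "A \<subseteq> cl (insert x (A - {f}))" using subset_cl[of "insert x (A - {f})"] by blast
qed

text \<open>Exchanging the last element of a chordless path with its predecessor in \<open>I\<close> keeps the
  \<open>cN\<close>-closure and leaves a shorter chordless path.\<close>

lemma chordless_path_augment:
  assumes "finitary_closure cM" "finitary_closure cN" "free cM I" "free cN I"
    and "chordless_path cM cN I n e f"
  shows "\<exists>J. finite (J - I) \<and> finite (I - J) \<and> free cM J \<and> free cN J \<and>
    cM J = cM (insert (e n) I) \<and> cN J = cN (insert (e 0) I)"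
  using assms(3-5)
proof (induction n arbitrary: I)
  case 0
  interpret M: finitary_closure cM by fact
  interpret N: finitary_closure cN by fact
  have "e 0 \<notin> cM I" "e 0 \<notin> cN I" using 0 unfolding chordless_path_def by auto
  moreover have "insert (e 0) I - I \<subseteq> {e 0}" by blast
  ultimately show ?case
    using M.free_insert N.free_insert 0
    by (intro exI[of _ "insert (e 0) I"]) (auto intro: finite_subset)
next
  case (Suc n)
  interpret M: finitary_closure cM by fact
  interpret N: finitary_closure cN by fact
  define x g I' where "x = e (Suc n)" and "g = f n" and "I' = insert x (I - {g})"
  note defs = Suc.prems(3)[unfolded chordless_path_def]
  have step: "f i \<in> I" "e i \<notin> cM (I - {f i})" "e (Suc i) \<notin> cN (I - {f i})" if "i \<le> n" for i
    using defs that by auto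
  have chordM: "e i \<in> cM (I - {f j})" if "i < j" "j \<le> n" for i j
    using defs that by auto
  have chordN: "e j \<in> cN (I - {f i})" if "Suc i < j" "j \<le> Suc n" for i j
    using defs that by auto
  have e0: "e 0 \<notin> cN I" and spanN: "\<And>i. 0 < i \<Longrightarrow> i \<le> Suc n \<Longrightarrow> e i \<in> cN I"
    and spanM: "\<And>i. i \<le> n \<Longrightarrow> e i \<in> cM I" and xM: "x \<notin> cM I"
    using defs unfolding x_def by auto
  have g: "g \<in> I" "e n \<notin> cM (I - {g})" "x \<notin> cN (I - {g})"
    using step[of n] unfolding x_def g_def by auto
  have xN: "x \<in> cN I" using spanN[of "Suc n"] unfolding x_def by simp
  have xI: "x \<notin> I" using xM M.in_cl[of x I] by blast
  have clN: "cN I' = cN I" unfolding I'_def using N.cl_swap xN g by blast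
  have "free cM I'" unfolding I'_def
    using M.free_insert[OF M.free_subset[OF \<open>free cM I\<close>]] xM M.in_cl_mono[of x "I - {g}" I] by blast
  moreover have "free cN I'" unfolding I'_def
    using N.free_insert[OF N.free_subset[OF \<open>free cN I\<close>] g(3)] by blast
  moreover have "chordless_path cM cN I' n e f"
    unfolding chordless_path_def
  proof (intro conjI allI impI; (elim conjE)?)
    fix i assume i: "i < n"
    have "f i \<noteq> g" using chordM[of i n] step(2)[of i] i unfolding g_def by auto
    then show "f i \<in> I'" unfolding I'_def using step(1)[of i] i by simp
    have I'fi: "I' - {f i} = insert x (I - {g, f i})"
      unfolding I'_def using xI step(1)[of i] i by auto
    show "e i \<notin> cM (I' - {f i})"
    proof
      assume "e i \<in> cM (I' - {f i})"
      moreover have "e i \<notin> cM (I - {g, f i})"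
        using step(2)[of i] M.in_cl_mono[of "e i" "I - {g, f i}" "I - {f i}"] i by auto
      ultimately have "x \<in> cM (insert (e i) (I - {g, f i}))"
        unfolding I'fi by (rule M.cl_exchange)
      then have "x \<in> cM I"
        by (rule M.in_cl_trans) (use spanM[of i] i M.subset_cl[of I] in auto)
      then show False using xM by contradiction
    qed
    have xfi: "x \<in> cN (I - {f i})" using chordN[of i "Suc n"] i unfolding x_def by simp
    show "e (Suc i) \<notin> cN (I' - {f i})"
    proof
      assume "e (Suc i) \<in> cN (I' - {f i})"
      then have "e (Suc i) \<in> cN (I - {f i})"
        unfolding I'fi by (rule N.in_cl_trans) (use xfi N.subset_cl[of "I - {f i}"] in auto)
      then show False using step(3)[of i] i by simp
    qed
  next
    fix i j assume ij: "i < j" "j < n"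
    have "e i \<in> cM (I - {f j, g})"
      using M.cl_Diff_pair[OF \<open>free cM I\<close>, of "e i"] chordM[of i j] chordM[of i n] ij
      unfolding g_def by simp
    moreover have "I - {f j, g} \<subseteq> I' - {f j}"
      unfolding I'_def by blast
    ultimately show "e i \<in> cM (I' - {f j})" by (rule M.in_cl_mono)
  next
    fix i j assume ij: "Suc i < j" "j \<le> n"
    have fi: "f i \<in> I" "x \<in> cN (I - {f i})"
      using step(1)[of i] chordN[of i "Suc n"] ij unfolding x_def by auto
    have I'fi: "I' - {f i} = insert x (I - {f i} - {g})"
      unfolding I'_def using xI fi(1) by auto
    have "g \<noteq> f i" using fi g by auto
    moreover have "x \<notin> cN (I - {f i} - {g})"
      using g(3) N.in_cl_mono[of x "I - {f i} - {g}" "I - {g}"] by blast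
    ultimately have "cN (I' - {f i}) = cN (I - {f i})"
      unfolding I'fi using N.cl_swap fi g(1) by simp
    then show "e j \<in> cN (I' - {f i})" using chordN[of i j] ij by simp
  next
    show "e 0 \<notin> cN I'" using clN e0 by simp
  next
    fix i assume "0 < i" "i \<le> n"
    then show "e i \<in> cN I'" using clN spanN by simp
  next
    fix i assume i: "i < n"
    show "e i \<in> cM I'"
      using M.in_cl_mono[OF chordM[of i n], of I'] i unfolding I'_def g_def by blast
  next
    show "e n \<notin> cM I'"
    proof
      assume "e n \<in> cM I'"
      then have "x \<in> cM (insert (e n) (I - {g}))"
        unfolding I'_def using g(2) by (rule M.cl_exchange)
      then have "x \<in> cM I"
        by (rule M.in_cl_trans) (use spanM[of n] M.subset_cl[of I] in auto)
      then show False using xM by contradiction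
    qed
  qed
  ultimately obtain J where J: "finite (J - I')" "finite (I' - J)" "free cM J" "free cN J"
    "cM J = cM (insert (e n) I')" "cN J = cN (insert (e 0) I')"
    using Suc.IH by blast
  have "J - I \<subseteq> insert x (J - I')" "I - J \<subseteq> insert g (I' - J)" unfolding I'_def by auto
  then have "finite (J - I)" "finite (I - J)" using J(1,2) by (auto intro: finite_subset)
  moreover have "cM J = cM (insert (e (Suc n)) I)"
  proof -
    have eq: "cM (insert (e n) (I - {g})) = cM I"
      using M.cl_swap[of "e n" I g] spanM[of n] g by simp
    have "insert (e n) I' = insert x (insert (e n) (I - {g}))" unfolding I'_def by blast
    moreover have "cM (insert x (insert (e n) (I - {g}))) = cM (insert x I)"
    proof (rule antisym; rule M.cl_leI)
      show "insert x (insert (e n) (I - {g})) \<subseteq> cM (insert x I)"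
        using M.subset_cl[of "insert x I"] M.in_cl_mono[OF spanM[of n], of "insert x I"] by auto
      have "I \<subseteq> cM (insert (e n) (I - {g}))" using eq M.subset_cl by simp
      also have "\<dots> \<subseteq> cM (insert x (insert (e n) (I - {g})))" by (rule M.cl_mono) blast
      finally show "insert x I \<subseteq> cM (insert x (insert (e n) (I - {g})))"
        using M.subset_cl[of "insert x (insert (e n) (I - {g}))"] by blast
    qed
    ultimately show ?thesis using J(5) unfolding x_def by simp
  qed
  moreover have "cN (insert (e 0) I') = cN (insert (e 0) I)"
  proof (rule antisym; rule N.cl_leI)
    have "I' \<subseteq> cN (insert (e 0) I)" "I \<subseteq> cN (insert (e 0) I')"
      using clN N.subset_cl[of I] N.subset_cl[of I'] N.cl_mono[OF subset_insertI]
      by blast+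
    then show "insert (e 0) I' \<subseteq> cN (insert (e 0) I)" "insert (e 0) I \<subseteq> cN (insert (e 0) I')"
      using N.subset_cl[of "insert (e 0) I"] N.subset_cl[of "insert (e 0) I'"] by auto
  qed
  ultimately show ?case using J by auto
qed

lemma augment:
  assumes "finitary_closure cM" "finitary_closure cN" "free cM I" "free cN I"
    and "\<not> reach cM cN I \<subseteq> cM I"
  obtains J t u where "finite (J - I)" "finite (I - J)" "free cM J" "free cN J"
    "t \<notin> cM I" "cM J = cM (insert t I)" "u \<notin> cN I" "cN J = cN (insert u I)"
proof -
  have "\<exists>n. \<not> layer cM cN I n \<subseteq> cM I" using assms(5) unfolding reach_def by blast
  then obtain n where n: "\<not> layer cM cN I n \<subseteq> cM I" "\<And>m. m < n \<Longrightarrow> layer cM cN I m \<subseteq> cM I"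
    using exists_least_iff[of "\<lambda>n. \<not> layer cM cN I n \<subseteq> cM I"] by blast
  then obtain x where "x \<in> layer cM cN I n" "x \<notin> cM I" by blast
  then obtain e f where path: "chordless_path cM cN I n e f"
    using chordless_path_exists n(2) by metis
  then have "e n \<notin> cM I" "e 0 \<notin> cN I" unfolding chordless_path_def by auto
  with chordless_path_augment[OF assms(1-4) path] show thesis using that by metis
qed

lemma reach_subset_cl:
  assumes "finitary_closure cM" "free cM I" "free cN I" "X \<subseteq> reach cM cN I" "X \<subseteq> cM I"
  shows "X \<subseteq> cM (I \<inter> reach cM cN I)"
proof
  interpret M: finitary_closure cM by fact
  fix x assume x: "x \<in> X"
  have "contract cM {} = cM" by (simp add: contract_def fun_eq_iff)
  then have "x \<in> cM {h \<in> I. x \<notin> cM (I - {h})}"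
    using M.cl_circuit[of "{}" I x] assms x by auto
  moreover have "{h \<in> I. x \<notin> cM (I - {h})} \<subseteq> I \<inter> reach cM cN I"
    using reach_step[of x cM cN I] assms(3,4) x unfolding free_def by blast
  ultimately show "x \<in> cM (I \<inter> reach cM cN I)" by (rule M.in_cl_mono)
qed

lemma Compl_reach_subset_cl:
  assumes "finitary_closure cN" "free cM I" "free cN I"
  shows "- reach cM cN I \<subseteq> cN (I - reach cM cN I)"
proof
  interpret N: finitary_closure cN by fact
  fix x assume x: "x \<in> - reach cM cN I"
  have "contract cN {} = cN" by (simp add: contract_def fun_eq_iff)
  then have "x \<in> cN {h \<in> I. x \<notin> cN (I - {h})}"
    using N.cl_circuit[of "{}" I x] assms(3) x reach_source[of x cN I cM] by auto
  moreover have "{h \<in> I. x \<notin> cN (I - {h})} \<subseteq> I - reach cM cN I"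
  proof
    fix h assume h: "h \<in> {h \<in> I. x \<notin> cN (I - {h})}"
    then have "h \<notin> cM (I - {h})" using assms(2) unfolding free_def by blast
    then show "h \<in> I - reach cM cN I" using reach_step[of h cM cN I h x] h x by blast
  qed
  ultimately show "x \<in> cN (I - reach cM cN I)" by (rule N.in_cl_mono)
qed

section \<open>Obstructions\<close>

definition obstruction ::
  "('a set \<Rightarrow> 'a set) \<Rightarrow> ('a set \<Rightarrow> 'a set) \<Rightarrow> 'a set \<Rightarrow> bool" where
  "obstruction cM cN H \<longleftrightarrow> free (contract cN (- cM H)) H \<and> cN (- cM H \<union> H) \<noteq> UNIV"

lemma obstructionI:
  assumes "finitary_closure cN" "S \<subseteq> cM H" "free (contract cN (- S)) H" "cN (- S \<union> H) \<noteq> UNIV"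
  shows "obstruction cM cN H"
proof -
  interpret N: finitary_closure cN by fact
  have sub: "- cM H \<subseteq> - S" using assms(2) by blast
  have "free (contract cN (- cM H)) H"
    using order_trans[OF sub N.subset_cl] by (rule N.free_contract_antimono[OF assms(3)])
  moreover have "cN (- cM H \<union> H) \<subseteq> cN (- S \<union> H)"
    using sub by (intro N.cl_mono Un_mono order_refl)
  ultimately show ?thesis using assms(4) unfolding obstruction_def by blast
qed

lemma obstruction_if_not_augmentable:
  assumes "finitary_closure cM" "finitary_closure cN" "free cM I" "free cN I"
    and "reach cM cN I \<subseteq> cM I" "cN I \<noteq> UNIV"
  shows "obstruction cM cN (I \<inter> reach cM cN I)"
proof -
  interpret N: finitary_closure cN by fact
  let ?S = "reach cM cN I"
  have co: "- ?S \<subseteq> cN (I - ?S)" using Compl_reach_subset_cl assms(2-4) .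
  show ?thesis
  proof (rule obstructionI)
    show "finitary_closure cN" by fact
    show "?S \<subseteq> cM (I \<inter> ?S)" using reach_subset_cl[OF assms(1,3,4) order_refl assms(5)] .
    have "free (contract cN (I - ?S)) (I \<inter> ?S)"
    proof (rule N.free_contractI)
      show "free cN ((I - ?S) \<union> (I \<inter> ?S))" using assms(4) by (rule N.free_subset) blast
    qed blast
    then show "free (contract cN (- ?S)) (I \<inter> ?S)" using co by (rule N.free_contract_antimono)
    have "I - ?S \<subseteq> I" by blast
    then have "- ?S \<union> (I \<inter> ?S) \<subseteq> cN I"
      using co N.cl_mono[of "I - ?S" I] N.subset_cl[of I] by blast
    then show "cN (- ?S \<union> (I \<inter> ?S)) \<noteq> UNIV" using assms(6) N.cl_leI by blast
  qed
qed

lemma (in finitary_closure) cl_Un_cong: "cl A = cl B \<Longrightarrow> cl (A \<union> C) = cl (B \<union> C)"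
proof -
  have "cl (A \<union> C) \<subseteq> cl (B \<union> C)" if "cl A \<subseteq> cl B" for A B
    using that subset_cl[of A] subset_cl[of "B \<union> C"] cl_mono[of B "B \<union> C"]
    by (intro cl_leI) blast
  then show "cl A = cl B \<Longrightarrow> cl (A \<union> C) = cl (B \<union> C)" by (intro antisym) auto
qed

lemma obstruction_exists_finite:
  assumes "finitary_closure cM" "finitary_closure cN"
  shows "\<lbrakk>free cM I; free cN I; finite T; cM (I \<union> T) = UNIV;
    \<And>W. finite W \<Longrightarrow> card W \<le> card T \<Longrightarrow> cN (I \<union> W) \<noteq> UNIV\<rbrakk> \<Longrightarrow> \<exists>H. obstruction cM cN H"
proof (induction "card T" arbitrary: I T rule: less_induct)
  case less
  interpret M: finitary_closure cM by fact
  interpret N: finitary_closure cN by fact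
  show ?case
  proof (cases "reach cM cN I \<subseteq> cM I")
    case True
    then show ?thesis
      using obstruction_if_not_augmentable[OF assms less.prems(1,2)] less.prems(5)[of "{}"] by auto
  next
    case False
    obtain J t u where J: "free cM J" "free cN J" "t \<notin> cM I" "cM J = cM (insert t I)"
      "cN J = cN (insert u I)"
      by (rule augment[OF assms less.prems(1,2) False])
    have "t \<in> cM (I \<union> T)" using less.prems(4) by simp
    then obtain K where K: "finite K" "K \<subseteq> T" "t \<in> cM (I \<union> K)"
        "\<And>k. k \<in> K \<Longrightarrow> t \<notin> cM (I \<union> (K - {k}))"
      by (rule M.minimal_support) blast
    note K = K(2-)
    have "K \<noteq> {}" using K(2) J(3) by auto
    then obtain k where k: "k \<in> K" by blast
    have "k \<in> cM (insert t (I \<union> (K - {k})))"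
      using M.minimal_support_exchange K(2,3) k by blast
    then have "k \<in> cM (insert t I \<union> (T - {k}))"
      by (rule M.in_cl_mono) (use K(1) in auto)
    then have "cM (I \<union> T) \<subseteq> cM (insert t I \<union> (T - {k}))"
      using M.subset_cl[of "insert t I \<union> (T - {k})"] by (intro M.cl_leI) auto
    then have span: "cM (J \<union> (T - {k})) = UNIV"
      using less.prems(4) M.cl_Un_cong[OF J(4)] by auto
    have cardT: "Suc (card (T - {k})) = card T"
      using less.prems(3) K(1) k by (intro card_Suc_Diff1) auto
    show ?thesis
    proof (rule less.hyps)
      show "card (T - {k}) < card T" using cardT by simp
      fix W :: "'a set" assume W: "finite W" "card W \<le> card (T - {k})"
      then have "card (insert u W) \<le> card T"
        using cardT card_insert_le_m1[of "card T" W u] by simp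
      then have "cN (I \<union> insert u W) \<noteq> UNIV" by (intro less.prems(5)) (use W(1) in auto)
      then show "cN (J \<union> W) \<noteq> UNIV" using N.cl_Un_cong[OF J(5), of W] by simp
    qed (use J span less.prems(3) in auto)
  qed
qed

section \<open>Infinite rank\<close>

lemma card_of_Un_ordLeq: "infinite B \<Longrightarrow> |A1| \<le>o |B| \<Longrightarrow> |A2| \<le>o |B| \<Longrightarrow> |A1 \<union> A2| \<le>o |B|"
  by (rule card_of_Un_ordLeq_infinite_Field) (auto simp: Field_card_of card_of_card_order_on)

lemma small_closed_superset:
  assumes "infinite B" "|X| \<le>o |B|" "\<And>F. finite F \<Longrightarrow> |h F| \<le>o |B|"
  obtains W where "X \<subseteq> W" "|W| \<le>o |B|" "\<And>F. finite F \<Longrightarrow> F \<subseteq> W \<Longrightarrow> h F \<subseteq> W"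
proof -
  define V where "V = rec_nat X (\<lambda>_ V. V \<union> (\<Union>F\<in>Fpow V. h F))"
  have V0: "V 0 = X" and VS: "V (Suc n) = V n \<union> (\<Union>F\<in>Fpow (V n). h F)" for n
    unfolding V_def by simp_all
  have small: "|V n| \<le>o |B|" for n
  proof (induction n)
    case 0
    then show ?case using V0 assms(2) by simp
  next
    case (Suc n)
    have "|\<Union>F\<in>Fpow (V n). h F| \<le>o |B|"
      by (intro card_of_UNION_ordLeq_infinite assms(1) card_of_Fpow_ordLeq Suc ballI assms(3))
        (simp add: Fpow_def)
    then show ?case unfolding VS by (rule card_of_Un_ordLeq[OF assms(1) Suc])
  qed
  have mono: "V m \<subseteq> V n" if "m \<le> n" for m n
    using that by (rule lift_Suc_mono_le[rotated]) (simp add: VS)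
  show thesis
  proof
    show "X \<subseteq> (\<Union>n. V n)" using V0 by blast
    show "|\<Union>n. V n| \<le>o |B|"
      using assms(1) small infinite_iff_card_of_nat
      by (intro card_of_UNION_ordLeq_infinite) auto
    fix F assume F: "finite F" "F \<subseteq> (\<Union>n. V n)"
    have "\<exists>n. F \<subseteq> V n"
      using F
    proof (induction rule: finite_induct)
      case (insert x F)
      then obtain n m where "F \<subseteq> V n" "x \<in> V m" by blast
      then have "insert x F \<subseteq> V (max n m)" using mono[of n "max n m"] mono[of m "max n m"] by auto
      then show ?case by blast
    qed simp
    then obtain n where "F \<in> Fpow (V n)" using F(1) unfolding Fpow_def by blast
    then have "h F \<subseteq> V (Suc n)" unfolding VS by blast
    then show "h F \<subseteq> (\<Union>n. V n)" by blast
  qed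
qed

lemma contract_contract: "contract (contract cl X) Y = contract cl (X \<union> Y)"
  by (simp add: contract_def fun_eq_iff Un_assoc)

locale infinite_corank = M: finitary_closure cM + N: finitary_closure cN
  for cM cN :: "'a set \<Rightarrow> 'a set" +
  fixes I T C :: "'a set"
  assumes freeM: "free cM (I \<union> T)" and spanM: "cM (I \<union> T) = UNIV"
    and freeN: "free cN (I \<union> C)" and disjN: "I \<inter> C = {}" and spanN: "cN (I \<union> C) = UNIV"
    and infinite_T: "infinite T" and less_card: "|T| <o |C|"
begin

definition suppM :: "'a \<Rightarrow> 'a set" where
  "suppM x = (SOME F. finite F \<and> F \<subseteq> I \<union> T \<and> x \<in> cM F)"

definition suppN :: "'a \<Rightarrow> 'a set" where
  "suppN x = (SOME F. finite F \<and> F \<subseteq> I \<union> C \<and> x \<in> cN F)"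

lemma suppM: "finite (suppM x)" "suppM x \<subseteq> I \<union> T" "x \<in> cM (suppM x)"
proof -
  have "\<exists>F. finite F \<and> F \<subseteq> I \<union> T \<and> x \<in> cM F" using M.cl_finite[of x "I \<union> T"] spanM by simp
  from someI_ex[OF this] show "finite (suppM x)" "suppM x \<subseteq> I \<union> T" "x \<in> cM (suppM x)"
    unfolding suppM_def by auto
qed

lemma suppN: "finite (suppN x)" "suppN x \<subseteq> I \<union> C" "x \<in> cN (suppN x)"
proof -
  have "\<exists>F. finite F \<and> F \<subseteq> I \<union> C \<and> x \<in> cN F" using N.cl_finite[of x "I \<union> C"] spanN by simp
  from someI_ex[OF this] show "finite (suppN x)" "suppN x \<subseteq> I \<union> C" "x \<in> cN (suppN x)"
    unfolding suppN_def by auto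
qed

definition good :: "'a set \<Rightarrow> bool" where
  "good W \<longleftrightarrow> T \<subseteq> W \<and> |W| \<le>o |T| \<and> (\<forall>x\<in>W. suppM x \<subseteq> W \<and> suppN x \<subseteq> W)"

lemma good_freeM:
  assumes "good W"
  shows "free (contract cM W) (I - W)"
proof (rule M.free_contract_antimono)
  show "free (contract cM ((I \<union> T) \<inter> W)) (I - W)"
    using freeM by (intro M.free_contractI) (auto intro: M.free_subset)
  show "W \<subseteq> cM ((I \<union> T) \<inter> W)"
  proof
    fix x assume "x \<in> W"
    then have "suppM x \<subseteq> (I \<union> T) \<inter> W" using assms suppM(2) unfolding good_def by blast
    then show "x \<in> cM ((I \<union> T) \<inter> W)" using M.in_cl_mono[OF suppM(3)] by blast
  qed
qed

lemma good_freeN: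
  assumes "good W"
  shows "free (contract cN W) (I - W)"
proof (rule N.free_contract_antimono)
  show "free (contract cN ((I \<union> C) \<inter> W)) (I - W)"
    using freeN by (intro N.free_contractI) (auto intro: N.free_subset)
  show "W \<subseteq> cN ((I \<union> C) \<inter> W)"
  proof
    fix x assume "x \<in> W"
    then have "suppN x \<subseteq> (I \<union> C) \<inter> W" using assms suppN(2) unfolding good_def by blast
    then show "x \<in> cN ((I \<union> C) \<inter> W)" using N.in_cl_mono[OF suppN(3)] by blast
  qed
qed

lemma good_superset:
  assumes "|X| \<le>o |T|" "\<And>F. finite F \<Longrightarrow> |g F| \<le>o |T|"
  obtains W where "good W" "X \<subseteq> W" "\<And>F. finite F \<Longrightarrow> F \<subseteq> W \<Longrightarrow> g F \<subseteq> W"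
proof -
  define h where "h F = g F \<union> (\<Union>x\<in>F. suppM x \<union> suppN x)" for F
  have Un: "|A \<union> B| \<le>o |T|" if "|A| \<le>o |T|" "|B| \<le>o |T|" for A B :: "'a set"
    using infinite_T that by (rule card_of_Un_ordLeq)
  have "|h F| \<le>o |T|" if "finite F" for F
    unfolding h_def
  proof (rule Un)
    show "|g F| \<le>o |T|" using assms(2) that .
    show "|\<Union>x\<in>F. suppM x \<union> suppN x| \<le>o |T|"
      using that suppM(1) suppN(1) by (intro finite_ordLeq_infinite infinite_T) auto
  qed
  moreover have "|X \<union> T| \<le>o |T|" using Un assms(1) by (simp add: card_of_mono1)
  ultimately obtain W where W: "X \<union> T \<subseteq> W" "|W| \<le>o |T|"
      "\<And>F. finite F \<Longrightarrow> F \<subseteq> W \<Longrightarrow> h F \<subseteq> W"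
    using small_closed_superset[OF infinite_T, of "X \<union> T" h] by metis
  have "suppM x \<subseteq> W \<and> suppN x \<subseteq> W" if "x \<in> W" for x
    using W(3)[of "{x}"] that unfolding h_def by simp
  then have "good W" using W(1,2) unfolding good_def by simp
  moreover have "g F \<subseteq> W" if "finite F" "F \<subseteq> W" for F
    using W(3)[OF that] unfolding h_def by simp
  ultimately show thesis using that W(1) by blast
qed

lemma good_Union:
  assumes "\<W> \<noteq> {}" "\<And>W. W \<in> \<W> \<Longrightarrow> good W" "|\<Union>\<W>| \<le>o |T|"
  shows "good (\<Union>\<W>)"
  unfolding good_def
proof (intro conjI ballI assms(3))
  show "T \<subseteq> \<Union>\<W>" using assms(1,2) unfolding good_def by blast
  fix x assume "x \<in> \<Union>\<W>"
  then obtain W where "W \<in> \<W>" "x \<in> W" by blast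
  then have "suppM x \<subseteq> W" "suppN x \<subseteq> W" using assms(2) unfolding good_def by auto
  then show "suppM x \<subseteq> \<Union>\<W>" "suppN x \<subseteq> \<Union>\<W>" using \<open>W \<in> \<W>\<close> by auto
qed

definition reach_off :: "'a set \<Rightarrow> 'a set" where
  "reach_off W = reach (contract cM W) (contract cN W) (I - W)"

lemma reach_off_antimono:
  assumes "W \<subseteq> W'"
  shows "reach_off W' \<subseteq> reach_off W"
proof
  fix e assume "e \<in> reach_off W'"
  then show "e \<in> reach_off W"
    unfolding reach_off_def
  proof (induction rule: reach_induct)
    case (source e)
    moreover have "W \<union> (I - W) \<subseteq> W' \<union> (I - W')" using assms by blast
    ultimately show ?case
      using N.in_cl_mono unfolding contract_def by (intro reach_source) (auto simp: contract_def)
  next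
    case (step e e' f)
    have sub: "W \<union> (I - W - {f}) \<subseteq> W' \<union> (I - W' - {f})" using assms step.hyps(2) by blast
    show ?case
    proof (rule reach_step)
      show "f \<in> I - W" using step.hyps(2) assms by blast
      show "e \<notin> contract cM W (I - W - {f})"
        using step.hyps(3) M.cl_mono[OF sub] unfolding contract_def by blast
      show "e' \<notin> contract cN W (I - W - {f})"
        using step.hyps(4) N.cl_mono[OF sub] unfolding contract_def by blast
    qed fact
  qed
qed

lemma reach_off_disjoint: "reach_off W \<inter> W = {}"
proof -
  have "e \<notin> W" if "e \<in> reach_off W" for e
    using that unfolding reach_off_def
  proof (induction rule: reach_induct)
    case (source e)
    then show ?case using N.in_cl[of e "W \<union> (I - W)"] unfolding contract_def by blast
  next
    case (step e e' f)
    then show ?case using N.in_cl[of e' "W \<union> (I - W - {f})"] unfolding contract_def by blast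
  qed
  then show ?thesis by blast
qed

lemma good_span_UNIV: "good W \<Longrightarrow> cM (W \<union> I) = UNIV"
  using M.cl_mono[of "I \<union> T" "W \<union> I"] spanM unfolding good_def by blast

lemma reach_off_span:
  assumes "good W"
  shows "reach_off W \<subseteq> cM (W \<union> (I \<inter> reach_off W))"
proof -
  have "reach_off W \<subseteq> contract cM W ((I - W) \<inter> reach_off W)"
    unfolding reach_off_def
    using M.finitary_closure_contract good_freeM[OF assms] good_freeN[OF assms] order_refl
    by (rule reach_subset_cl) (simp add: contract_def good_span_UNIV[OF assms])
  also have "\<dots> \<subseteq> cM (W \<union> (I \<inter> reach_off W))"
    unfolding contract_def by (intro M.cl_mono) blast
  finally show ?thesis .
qed

lemma Compl_reach_off_span:
  assumes "good W"
  shows "- reach_off W \<subseteq> cN (W \<union> (I - reach_off W))"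
proof -
  have "- reach_off W \<subseteq> contract cN W (I - W - reach_off W)"
    unfolding reach_off_def
    using N.finitary_closure_contract good_freeM[OF assms] good_freeN[OF assms]
    by (rule Compl_reach_subset_cl)
  also have "\<dots> \<subseteq> cN (W \<union> (I - reach_off W))"
    unfolding contract_def by (intro N.cl_mono) blast
  finally show ?thesis .
qed

definition saturated :: "'a set \<Rightarrow> bool" where
  "saturated Z \<longleftrightarrow> good Z \<and> (\<forall>K W. finite K \<and> K \<subseteq> Z \<and> good W \<and>
     free (contract cM (reach_off W)) K \<longrightarrow> free (contract cM (reach_off Z)) K)"

lemma saturated_exists: "\<exists>Z. saturated Z"
proof -
  define P where "P K W \<longleftrightarrow> good W \<and> free (contract cM (reach_off W)) K" for K W
  define g where "g K = (if \<exists>W. P K W then SOME W. P K W else {})" for K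
  have g: "P K (g K)" if "P K W" for K W
    using that someI_ex[of "P K"] unfolding g_def by auto
  have "|g K| \<le>o |T|" for K
  proof (cases "\<exists>W. P K W")
    case True
    then show ?thesis using g unfolding P_def good_def by blast
  next
    case False
    then have "g K = {}" unfolding g_def by (simp only: if_False)
    then show ?thesis by (simp add: card_of_empty)
  qed
  then obtain Z where Z: "good Z" "\<And>F. finite F \<Longrightarrow> F \<subseteq> Z \<Longrightarrow> g F \<subseteq> Z"
    using good_superset[of "{}" g] card_of_empty by metis
  have "saturated Z"
    unfolding saturated_def
  proof (intro conjI Z(1) allI impI; elim conjE)
    fix K W assume K: "finite K" "K \<subseteq> Z" and "good W" "free (contract cM (reach_off W)) K"
    then have "P K (g K)" using g unfolding P_def by blast
    moreover have "reach_off Z \<subseteq> reach_off (g K)" using Z(2) K by (intro reach_off_antimono)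
    ultimately show "free (contract cM (reach_off Z)) K"
      using M.free_contract_antimono[of "reach_off (g K)" K "reach_off Z"]
        M.subset_cl[of "reach_off (g K)"] unfolding P_def by blast
  qed
  then show ?thesis by blast
qed

text \<open>Otherwise a minimal finite \<open>K \<subseteq> Z\<close> needed to span a counterexample would be free over
  \<open>reach_off W\<close>, but not over \<open>reach_off Z\<close>.\<close>

lemma saturated_span:
  assumes "saturated Z" "good W" "Z \<subseteq> W"
  shows "reach_off Z \<subseteq> cM (reach_off W \<union> (I \<inter> reach_off Z))" (is "_ \<subseteq> cM ?A")
proof (rule subsetI, rule ccontr)
  fix s assume s: "s \<in> reach_off Z" "s \<notin> cM ?A"
  have Z: "good Z" using assms(1) unfolding saturated_def by blast
  have A: "?A \<subseteq> reach_off Z" using reach_off_antimono[OF assms(3)] by blast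
  have "s \<in> cM (Z \<union> (I \<inter> reach_off Z))" using reach_off_span[OF Z] s(1) by blast
  then have "s \<in> cM (?A \<union> Z)" by (rule M.in_cl_mono) blast
  then obtain K where K: "finite K" "K \<subseteq> Z" "s \<in> cM (?A \<union> K)"
      and min: "\<And>k. k \<in> K \<Longrightarrow> s \<notin> cM (?A \<union> (K - {k}))"
    by (rule M.minimal_support) blast
  have "free (contract cM ?A) K" using K(3) min by (rule M.minimal_support_free)
  then have "free (contract cM (reach_off W)) K"
    by (rule M.free_contract_antimono) (use M.subset_cl[of ?A] in blast)
  then have free: "free (contract cM (reach_off Z)) K"
    using assms K unfolding saturated_def by blast
  obtain k where k: "k \<in> K" using K(3) s(2) by (cases "K = {}") auto
  have "k \<in> cM (insert s (?A \<union> (K - {k})))"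
    using K(3) min[OF k] k by (rule M.minimal_support_exchange)
  then have "k \<in> cM (reach_off Z \<union> (K - {k}))"
    by (rule M.in_cl_mono) (use A s(1) in auto)
  then show False using free k unfolding free_def contract_def by blast
qed

end

lemma (in finitary_closure) not_free_contract_mono:
  assumes "A \<subseteq> cl B" "\<not> free (contract cl A) K"
  shows "\<not> free (contract cl B) K"
  using assms free_contract_antimono by blast

context infinite_corank
begin

definition partial :: "'a set \<Rightarrow> 'a set \<times> 'a set \<Rightarrow> bool" where
  "partial Z p \<longleftrightarrow> (case p of (W, L) \<Rightarrow>
     good W \<and> Z \<subseteq> W \<and> L \<subseteq> W \<inter> reach_off Z \<and> free cM L \<and>
     free (contract cN (- reach_off Z)) L \<and> I \<inter> reach_off Z \<inter> W \<subseteq> cM L)"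

definition completion :: "'a set \<Rightarrow> 'a set \<times> 'a set \<Rightarrow> 'a set" where
  "completion Z p = snd p \<union> (I \<inter> reach_off Z - fst p)"

definition trace :: "'a set \<Rightarrow> 'a set \<times> 'a set \<Rightarrow> 'a set set" where
  "trace Z p = {K \<in> Fpow Z. \<not> free (contract cM (completion Z p)) K}"

text \<open>A strict extension must enlarge the trace. Since traces are subsets of \<open>Fpow Z\<close>, the union of
  a chain is the union of at most \<open>|T|\<close> of its members, and therefore small.\<close>

definition extends :: "'a set \<Rightarrow> 'a set \<times> 'a set \<Rightarrow> 'a set \<times> 'a set \<Rightarrow> bool" where
  "extends Z p q \<longleftrightarrow> p = q \<or> (fst p \<subseteq> fst q \<and> snd p \<subseteq> snd q \<and> trace Z p \<subset> trace Z q)"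

lemma extendsD:
  assumes "extends Z p q"
  shows "fst p \<subseteq> fst q" "snd p \<subseteq> snd q" "trace Z p \<subseteq> trace Z q"
  using assms unfolding extends_def by auto

lemma trace_partial_mono:
  assumes "partial Z q" "fst p \<subseteq> fst q" "snd p \<subseteq> snd q"
  shows "trace Z p \<subseteq> trace Z q"
proof -
  have "I \<inter> reach_off Z \<inter> fst q \<subseteq> cM (completion Z q)"
    using assms(1) M.cl_mono[of "snd q" "completion Z q"]
    unfolding partial_def completion_def by (auto split: prod.splits)
  then have "completion Z p \<subseteq> cM (completion Z q)"
    using assms(2,3) M.subset_cl[of "completion Z q"] unfolding completion_def by blast
  then show ?thesis using M.not_free_contract_mono unfolding trace_def by blast
qed

lemma partial_chain_bounded:
  assumes sat: "saturated Z" and C: "\<C> \<in> Chains (relation_of (extends Z) (Collect (partial Z)))"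
  shows "\<exists>u\<in>Collect (partial Z). \<forall>p\<in>\<C>. extends Z p u"
proof -
  have part: "partial Z p" if "p \<in> \<C>" for p
    using that C unfolding Chains_def relation_of_def by blast
  have cmp: "extends Z p q \<or> extends Z q p" if "p \<in> \<C>" "q \<in> \<C>" for p q
    using that C unfolding Chains_def relation_of_def by blast
  have Z: "good Z" using sat unfolding saturated_def by blast
  consider "\<C> = {}" | m where "m \<in> \<C>" "\<forall>p\<in>\<C>. extends Z p m"
    | "\<C> \<noteq> {}" "\<And>m. m \<in> \<C> \<Longrightarrow> \<exists>p\<in>\<C>. \<not> extends Z p m" by blast
  then show ?thesis
  proof cases
    case 1
    have "partial Z (Z, {})"
      using Z reach_off_disjoint[of Z] M.free_empty
      unfolding partial_def by (auto simp: free_def)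
    then show ?thesis using 1 by blast
  next
    case 2
    then show ?thesis using part by blast
  next
    case 3
    have larger: "\<exists>q\<in>\<C>. fst p \<subseteq> fst q \<and> snd p \<subseteq> snd q \<and> trace Z p \<subset> trace Z q" if p: "p \<in> \<C>" for p
    proof -
      obtain q where q: "q \<in> \<C>" "\<not> extends Z q p" using 3(2) p by blast
      then have "extends Z p q" using cmp[OF p q(1)] by blast
      moreover have "p \<noteq> q" using q(2) unfolding extends_def by auto
      ultimately show ?thesis using q(1) unfolding extends_def by auto
    qed
    define W L where "W = (\<Union>p\<in>\<C>. fst p)" and "L = (\<Union>p\<in>\<C>. snd p)"
    have small: "|W| \<le>o |T|"
    proof -
      define U where "U = (\<Union>p\<in>\<C>. trace Z p)"
      have "\<forall>K\<in>U. \<exists>p\<in>\<C>. K \<in> trace Z p" unfolding U_def by blast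
      from bchoice[OF this[unfolded Bex_def]]
      obtain pick where pick: "\<And>K. K \<in> U \<Longrightarrow> pick K \<in> \<C> \<and> K \<in> trace Z (pick K)"
        by blast
      have "W \<subseteq> (\<Union>K\<in>U. fst (pick K))"
      proof
        fix x assume "x \<in> W"
        then obtain p where p: "p \<in> \<C>" "x \<in> fst p" unfolding W_def by blast
        then obtain q where q: "q \<in> \<C>" "trace Z p \<subset> trace Z q" using larger by blast
        then obtain K where K: "K \<in> trace Z q" "K \<notin> trace Z p" by blast
        then have "K \<in> U" using q(1) unfolding U_def by blast
        then have "\<not> extends Z (pick K) p" using pick[of K] K(2) extendsD(3) by blast
        then have "fst p \<subseteq> fst (pick K)"
          using cmp[OF p(1), of "pick K"] pick[OF \<open>K \<in> U\<close>] extendsD(1) by blast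
        then show "x \<in> (\<Union>K\<in>U. fst (pick K))" using p(2) \<open>K \<in> U\<close> by blast
      qed
      moreover have "|\<Union>K\<in>U. fst (pick K)| \<le>o |T|"
      proof (rule card_of_UNION_ordLeq_infinite[OF infinite_T])
        have "|Fpow Z| \<le>o |T|"
          using Z unfolding good_def by (intro card_of_Fpow_ordLeq infinite_T) auto
        moreover have "U \<subseteq> Fpow Z" unfolding U_def trace_def by blast
        ultimately show "|U| \<le>o |T|" by (rule ordLeq_transitive[OF card_of_mono1, rotated])
        show "\<forall>K\<in>U. |fst (pick K)| \<le>o |T|"
        proof
          fix K assume "K \<in> U"
          then have "partial Z (pick K)" using pick part by blast
          then show "|fst (pick K)| \<le>o |T|"
            unfolding partial_def good_def by (auto split: prod.splits)
        qed
      qed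
      ultimately show ?thesis by (rule ordLeq_transitive[OF card_of_mono1])
    qed
    have parts: "good (fst p)" "Z \<subseteq> fst p" "snd p \<subseteq> fst p" "snd p \<subseteq> reach_off Z" "free cM (snd p)"
      "free (contract cN (- reach_off Z)) (snd p)" "I \<inter> reach_off Z \<inter> fst p \<subseteq> cM (snd p)"
      if "p \<in> \<C>" for p
      using part[OF that] unfolding partial_def by (auto split: prod.splits)
    have chain: "subset.chain UNIV (snd ` \<C>)"
      unfolding subset_chain_def using cmp extendsD(2) by blast
    interpret NC: finitary_closure "contract cN (- reach_off Z)"
      by (rule N.finitary_closure_contract)
    have "good W" unfolding W_def
      by (rule good_Union) (use 3(1) parts(1) small W_def in auto)
    moreover have "Z \<subseteq> W" using 3(1) parts(2) unfolding W_def by blast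
    moreover have "L \<subseteq> W \<inter> reach_off Z" using parts(3,4) unfolding L_def W_def by blast
    moreover have "free cM L" unfolding L_def
      by (rule M.free_chain_Union[OF chain]) (use parts(5) in auto)
    moreover have "free (contract cN (- reach_off Z)) L" unfolding L_def
      by (rule NC.free_chain_Union[OF chain]) (use parts(6) in auto)
    moreover have "I \<inter> reach_off Z \<inter> W \<subseteq> cM L"
    proof
      fix x assume "x \<in> I \<inter> reach_off Z \<inter> W"
      then obtain p where p: "p \<in> \<C>" "x \<in> cM (snd p)" using parts(7) unfolding W_def by blast
      then show "x \<in> cM L" unfolding L_def by (elim M.in_cl_mono) blast
    qed
    ultimately have u: "partial Z (W, L)" unfolding partial_def by simp
    have "extends Z p (W, L)" if p: "p \<in> \<C>" for p
    proof -
      obtain q where q: "q \<in> \<C>" "trace Z p \<subset> trace Z q" using larger p by blast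
      have "trace Z q \<subseteq> trace Z (W, L)"
        using u by (rule trace_partial_mono) (use q(1) W_def L_def in auto)
      then show ?thesis using p q(2) unfolding extends_def W_def L_def by auto
    qed
    then show ?thesis using u by blast
  qed
qed

lemma maximal_partial:
  assumes "saturated Z"
  obtains p where "partial Z p" "\<And>q. partial Z q \<Longrightarrow> extends Z p q \<Longrightarrow> q = p"
proof -
  have "partial_order_on (Collect (partial Z)) (relation_of (extends Z) (Collect (partial Z)))"
    by (rule partial_order_on_relation_ofI) (auto simp: extends_def)
  from predicate_Zorn[OF this] partial_chain_bounded[OF assms]
  have "\<exists>m\<in>Collect (partial Z). \<forall>a\<in>Collect (partial Z). extends Z m a \<longrightarrow> a = m" .
  then show thesis using that by auto
qed

lemma partial_facts:
  assumes "saturated Z" "partial Z (W, L)"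
  defines "S \<equiv> reach_off Z"
  defines "K \<equiv> I \<inter> S - W"
  shows "good W" "Z \<subseteq> W" "L \<subseteq> W" "L \<subseteq> S" "free cM L" "free (contract cN (- S)) L"
    "I \<inter> S \<inter> W \<subseteq> cM L"
    and "free (contract cM L) K"
    and "free (contract cN (W \<union> - S)) K"
    and "- S \<subseteq> cN (W \<union> (I - S))"
proof -
  show W: "good W" and ZW: "Z \<subseteq> W" and LW: "L \<subseteq> W" and "L \<subseteq> S" "free cM L"
    "free (contract cN (- S)) L" "I \<inter> S \<inter> W \<subseteq> cM L"
    using assms(2) unfolding partial_def S_def by auto
  have "free (contract cM W) K"
    by (rule finitary_closure.free_subset[OF M.finitary_closure_contract good_freeM[OF W]])
      (auto simp: K_def)
  then show "free (contract cM L) K"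
    by (rule M.free_contract_antimono) (use LW M.subset_cl[of W] in blast)
  have "good Z" using assms(1) unfolding saturated_def by blast
  then have "- S \<subseteq> cN (Z \<union> (I - S))" unfolding S_def by (rule Compl_reach_off_span)
  also have "\<dots> \<subseteq> cN (W \<union> (I - S))" by (rule N.cl_mono) (use ZW in blast)
  finally show co: "- S \<subseteq> cN (W \<union> (I - S))" .
  interpret NW: finitary_closure "contract cN W" by (rule N.finitary_closure_contract)
  have "free (contract (contract cN W) (I - W - S)) K"
    by (rule NW.free_contractI, rule NW.free_subset[OF good_freeN[OF W]]) (auto simp: K_def)
  then have "free (contract cN (W \<union> (I - W - S))) K" by (simp only: contract_contract)
  moreover have "W \<union> (I - W - S) = W \<union> (I - S)" by blast
  ultimately have "free (contract cN (W \<union> (I - S))) K" by simp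
  then show "free (contract cN (W \<union> - S)) K"
    by (rule N.free_contract_antimono) (use co N.subset_cl[of "W \<union> (I - S)"] in blast)
qed

lemma reach_off_subset_reach:
  assumes "saturated Z" "partial Z (W, L)"
  defines "S \<equiv> reach_off Z"
  shows "reach_off W \<subseteq> reach (contract cM L) (contract cN (W \<union> - S)) (I \<inter> S - W)"
proof
  note facts = partial_facts[OF assms(1,2), folded S_def]
  have Z: "good Z" using assms(1) unfolding saturated_def by blast
  fix e assume "e \<in> reach_off W"
  then show "e \<in> reach (contract cM L) (contract cN (W \<union> - S)) (I \<inter> S - W)"
    unfolding reach_off_def[of W]
  proof (induction rule: reach_induct)
    case (source e)
    have "W \<union> - S \<union> (I \<inter> S - W) \<subseteq> cN (W \<union> (I - W))"
      using facts(10) N.subset_cl[of "W \<union> (I - W)"] N.cl_mono[of "W \<union> (I - S)" "W \<union> (I - W)"]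
      by blast
    then have "contract cN (W \<union> - S) (I \<inter> S - W) \<subseteq> contract cN W (I - W)"
      unfolding contract_def by (rule N.cl_leI)
    then show ?case using source by (intro reach_source) blast
  next
    case (step e e' f)
    have "e \<in> S" using step.hyps(1) reach_off_antimono[OF facts(2)]
      unfolding S_def reach_off_def[of W] by blast
    have f: "f \<in> S"
    proof (rule ccontr)
      assume "f \<notin> S"
      have "e \<in> cM (Z \<union> (I \<inter> S))" using reach_off_span[OF Z] \<open>e \<in> S\<close> unfolding S_def by blast
      then have "e \<in> contract cM W (I - W - {f})"
        unfolding contract_def by (rule M.in_cl_mono) (use facts(2) \<open>f \<notin> S\<close> in blast)
      then show False using step.hyps(3) by contradiction
    qed
    show ?case
    proof (rule reach_step[OF step.IH])
      show "f \<in> I \<inter> S - W" using f step.hyps(2) by blast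
      have "contract cM L (I \<inter> S - W - {f}) \<subseteq> contract cM W (I - W - {f})"
        unfolding contract_def by (rule M.cl_mono) (use facts(3) in blast)
      then show "e \<notin> contract cM L (I \<inter> S - W - {f})" using step.hyps(3) by blast
      have "W \<union> (I - S) \<subseteq> W \<union> (I - W - {f})" using f by blast
      then have "W \<union> - S \<union> (I \<inter> S - W - {f}) \<subseteq> cN (W \<union> (I - W - {f}))"
        using facts(10) N.subset_cl[of "W \<union> (I - W - {f})"]
          N.cl_mono[of "W \<union> (I - S)" "W \<union> (I - W - {f})"]
        by blast
      then have "contract cN (W \<union> - S) (I \<inter> S - W - {f}) \<subseteq> contract cN W (I - W - {f})"
        unfolding contract_def by (rule N.cl_leI)
      then show "e' \<notin> contract cN (W \<union> - S) (I \<inter> S - W - {f})" using step.hyps(4) by blast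
    qed
  qed
qed

lemma maximal_partial_spans:
  assumes "saturated Z" "partial Z (W, L)"
    and max: "\<And>q. partial Z q \<Longrightarrow> extends Z (W, L) q \<Longrightarrow> q = (W, L)"
  shows "reach_off Z \<subseteq> cM (completion Z (W, L))"
proof (rule ccontr)
  define S K where "S = reach_off Z" and "K = I \<inter> S - W"
  note facts = partial_facts[OF assms(1,2), folded S_def, folded K_def]
  have Z: "good Z" using assms(1) unfolding saturated_def by blast
  have tot: "completion Z (W, L) = L \<union> K" unfolding completion_def S_def K_def by simp
  assume "\<not> reach_off Z \<subseteq> cM (completion Z (W, L))"
  then have nspan: "\<not> S \<subseteq> cM (L \<union> K)" unfolding tot S_def .
  have "I \<inter> S \<inter> W \<subseteq> cM (L \<union> K)"
    using facts(7) M.cl_mono[of L "L \<union> K"] by blast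
  then have IS: "I \<inter> S \<subseteq> cM (L \<union> K)"
    using M.subset_cl[of "L \<union> K"] unfolding K_def by blast
  have "\<not> reach_off W \<subseteq> cM (L \<union> K)"
  proof
    assume "reach_off W \<subseteq> cM (L \<union> K)"
    then have "cM (reach_off W \<union> (I \<inter> S)) \<subseteq> cM (L \<union> K)"
      using IS by (intro M.cl_leI) blast
    then show False
      using nspan saturated_span[OF assms(1) facts(1,2)] unfolding S_def by blast
  qed
  then have "\<not> reach (contract cM L) (contract cN (W \<union> - S)) K \<subseteq> contract cM L K"
    using reach_off_subset_reach[OF assms(1,2)] unfolding contract_def[of cM] S_def K_def by blast
  then obtain J t u where J: "finite (J - K)" "finite (K - J)" "free (contract cM L) J"
      "free (contract cN (W \<union> - S)) J" "t \<notin> cM (L \<union> K)"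
      "cM (L \<union> J) = cM (L \<union> insert t K)"
    by (rule augment[OF M.finitary_closure_contract N.finitary_closure_contract facts(8,9)])
      (simp add: contract_def)
  have "|(J - K) \<union> (K - J) \<union> W| \<le>o |T|"
    by (rule card_of_Un_ordLeq[OF infinite_T finite_ordLeq_infinite[OF _ infinite_T]])
      (use facts(1) J(1,2) good_def in auto)
  then obtain W' where W': "good W'" "(J - K) \<union> (K - J) \<union> W \<subseteq> W'"
    using good_superset[of _ "\<lambda>_. {}"] card_of_empty by metis
  define L' where "L' = L \<union> (J \<inter> W')"
  have JS: "J \<subseteq> S"
  proof
    fix x assume "x \<in> J"
    then have "x \<notin> cN (W \<union> - S)" using N.free_contract_disjoint J(4) by blast
    then show "x \<in> S" using N.in_cl[of x "W \<union> - S"] by blast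
  qed
  have LJ: "L \<union> J \<subseteq> L' \<union> (I \<inter> S - W')"
    using W'(2) unfolding L'_def K_def by blast
  have tot': "completion Z (W', L') = L' \<union> (I \<inter> S - W')" unfolding completion_def S_def by simp
  have insert_sub: "L \<union> insert t K \<subseteq> cM (L \<union> J)"
    using J(6) M.subset_cl[of "L \<union> insert t K"] by simp
  also have le': "cM (L \<union> J) \<subseteq> cM (completion Z (W', L'))"
    unfolding tot' using LJ by (rule M.cl_mono)
  finally have tot_le: "completion Z (W, L) \<subseteq> cM (completion Z (W', L'))"
    and t': "t \<in> cM (completion Z (W', L'))" unfolding tot by auto
  have part': "partial Z (W', L')"
    unfolding partial_def prod.case S_def[symmetric]
  proof (intro conjI)
    show "good W'" by fact
    show "Z \<subseteq> W'" using facts(2) W'(2) by blast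
    show "L' \<subseteq> W' \<inter> S" using facts(3,4) W'(2) JS unfolding L'_def by blast
    have freeJ: "free (contract cM L) (J \<inter> W')"
      by (rule finitary_closure.free_subset[OF M.finitary_closure_contract J(3)]) blast
    show "free cM L'" unfolding L'_def using facts(5) freeJ by (rule M.free_Un)
    interpret NS: finitary_closure "contract cN (- S)" by (rule N.finitary_closure_contract)
    have "free (contract cN (W \<union> - S)) (J \<inter> W')"
      by (rule finitary_closure.free_subset[OF N.finitary_closure_contract J(4)]) blast
    then have "free (contract cN (- S \<union> L)) (J \<inter> W')"
      by (rule N.free_contract_antimono) (use facts(3) N.subset_cl[of "W \<union> - S"] in blast)
    then have "free (contract (contract cN (- S)) L) (J \<inter> W')" by (simp only: contract_contract)
    then show "free (contract cN (- S)) L'" unfolding L'_def by (rule NS.free_Un[OF facts(6)])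
    show "I \<inter> S \<inter> W' \<subseteq> cM L'"
    proof
      fix x assume x: "x \<in> I \<inter> S \<inter> W'"
      show "x \<in> cM L'"
      proof (rule M.cl_Un_free[OF good_freeM[OF W'(1)]])
        have "L' \<subseteq> W'" using facts(3) W'(2) unfolding L'_def by blast
        then show "L' \<subseteq> cM W'" using M.subset_cl[of W'] by blast
        show "x \<in> cM W'" using x M.subset_cl[of W'] by blast
        have "x \<in> cM (completion Z (W, L))" using x IS unfolding tot by blast
        then have "x \<in> cM (completion Z (W', L'))" using tot_le by (rule M.in_cl_trans)
        then show "x \<in> cM (L' \<union> (I - W'))" unfolding tot' by (rule M.in_cl_mono) blast
      qed
    qed
  qed
  have "t \<in> cM (completion Z (W, L) \<union> Z)"
  proof -
    have "t \<in> cM (L \<union> J)" using insert_sub by blast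
    moreover have "L \<union> J \<subseteq> cM (Z \<union> (I \<inter> S))"
      using facts(4) JS reach_off_span[OF Z] unfolding S_def by blast
    ultimately have "t \<in> cM (Z \<union> (I \<inter> S))" by (rule M.in_cl_trans)
    moreover have "Z \<union> (I \<inter> S) \<subseteq> cM (completion Z (W, L) \<union> Z)"
      unfolding tot using IS M.cl_mono[of "L \<union> K" "L \<union> K \<union> Z"] M.subset_cl[of "L \<union> K \<union> Z"] by blast
    ultimately show ?thesis by (rule M.in_cl_trans)
  qed
  then obtain F where F: "finite F" "F \<subseteq> Z" "t \<in> cM (completion Z (W, L) \<union> F)"
      and min: "\<And>k. k \<in> F \<Longrightarrow> t \<notin> cM (completion Z (W, L) \<union> (F - {k}))"
    by (rule M.minimal_support) blast
  have "F \<notin> trace Z (W, L)"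
    using M.minimal_support_free[OF F(3) min] unfolding trace_def by simp
  moreover have "F \<in> trace Z (W', L')"
  proof -
    obtain k where k: "k \<in> F" using F(3) J(5) unfolding tot by (cases "F = {}") auto
    have "k \<in> cM (insert t (completion Z (W, L) \<union> (F - {k})))"
      using F(3) min[OF k] k by (rule M.minimal_support_exchange)
    moreover have "insert t (completion Z (W, L) \<union> (F - {k})) \<subseteq> cM (completion Z (W', L') \<union> (F - {k}))"
      using t' tot_le M.cl_mono[of "completion Z (W', L')" "completion Z (W', L') \<union> (F - {k})"]
        M.subset_cl[of "completion Z (W', L') \<union> (F - {k})"] by blast
    ultimately have "k \<in> cM (completion Z (W', L') \<union> (F - {k}))" by (rule M.in_cl_trans)
    then have "\<not> free (contract cM (completion Z (W', L'))) F"
      using k unfolding free_def contract_def by blast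
    then show ?thesis using F(1,2) unfolding trace_def Fpow_def by simp
  qed
  moreover have sub: "fst (W, L) \<subseteq> fst (W', L')" "snd (W, L) \<subseteq> snd (W', L')"
    using W'(2) unfolding L'_def by auto
  moreover note trace_partial_mono[OF part' sub]
  ultimately have "extends Z (W, L) (W', L')" "trace Z (W, L) \<noteq> trace Z (W', L')"
    unfolding extends_def by auto
  then show False using max[OF part'] by simp
qed

lemma obstruction_exists: "\<exists>H. obstruction cM cN H"
proof -
  obtain Z where Z: "saturated Z" using saturated_exists by blast
  obtain W L where p: "partial Z (W, L)"
      and max: "\<And>q. partial Z q \<Longrightarrow> extends Z (W, L) q \<Longrightarrow> q = (W, L)"
    using maximal_partial[OF Z] by (metis surj_pair)
  define S K where "S = reach_off Z" and "K = I \<inter> S - W"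
  note facts = partial_facts[OF Z p, folded S_def, folded K_def]
  have tot: "completion Z (W, L) = L \<union> K" unfolding completion_def S_def K_def by simp
  have "obstruction cM cN (L \<union> K)"
  proof (rule obstructionI)
    show "finitary_closure cN" by (rule N.finitary_closure_axioms)
    show "S \<subseteq> cM (L \<union> K)" using maximal_partial_spans[OF Z p max] unfolding tot S_def .
    interpret NS: finitary_closure "contract cN (- S)" by (rule N.finitary_closure_contract)
    have "free (contract cN (- S \<union> L)) K"
      using facts(9) by (rule N.free_contract_antimono) (use facts(3) N.subset_cl[of "W \<union> - S"] in blast)
    then have "free (contract (contract cN (- S)) L) K" by (simp only: contract_contract)
    then show "free (contract cN (- S)) (L \<union> K)" by (rule NS.free_Un[OF facts(6)])
    show "cN (- S \<union> (L \<union> K)) \<noteq> UNIV"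
    proof
      assume "cN (- S \<union> (L \<union> K)) = UNIV"
      moreover have "- S \<union> (L \<union> K) \<subseteq> cN (I \<union> W)"
        using facts(3,10) N.subset_cl[of "I \<union> W"] N.cl_mono[of "W \<union> (I - S)" "I \<union> W"]
        unfolding K_def by blast
      ultimately have "cN (I \<union> W) = UNIV" using N.cl_leI by blast
      moreover have "free (contract cN I) C" using freeN disjN by (rule N.free_contractI)
      ultimately have "|C| \<le>o |W|"
        using finitary_closure.free_card_of_le[OF N.finitary_closure_contract, of I C W]
        unfolding contract_def by simp
      moreover have "|W| \<le>o |T|" using facts(1) unfolding good_def by blast
      ultimately have "|C| \<le>o |T|" by (rule ordLeq_transitive)
      then show False using less_card not_ordLess_ordLeq by blast
    qed
  qed
  then show ?thesis by blast
qed

end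

section \<open>The closure operator of a finitary matroid\<close>

text \<open>Elements outside the ground set become loops, so that the closure operator lives on the
  whole type.\<close>

definition matroid_cl :: "('a set \<Rightarrow> bool) \<Rightarrow> 'a set \<Rightarrow> 'a set" where
  "matroid_cl indep A = A \<union> {x. \<exists>F\<subseteq>A. finite F \<and> indep F \<and> \<not> indep (insert x F)}"

context
  fixes E :: "'a set" and indep :: "'a set \<Rightarrow> bool"
  assumes matroid: "finitary_matroid E indep"
begin

lemma indep_empty: "indep {}"
  using matroid[unfolded finitary_matroid_def, THEN conjunct1, rule_format] .

lemma indep_ground: "indep A \<Longrightarrow> A \<subseteq> E"
  using matroid[unfolded finitary_matroid_def, THEN conjunct2, THEN conjunct1, rule_format] .

lemma indep_subset: "indep B \<Longrightarrow> A \<subseteq> B \<Longrightarrow> indep A"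
  using matroid[unfolded finitary_matroid_def, THEN conjunct2, THEN conjunct2, THEN conjunct1, rule_format] by simp

lemma indep_augment:
  "indep A \<Longrightarrow> indep B \<Longrightarrow> finite A \<Longrightarrow> finite B \<Longrightarrow> card A < card B \<Longrightarrow> \<exists>x\<in>B - A. indep (insert x A)"
  using matroid[unfolded finitary_matroid_def, THEN conjunct2, THEN conjunct2, THEN conjunct2, THEN conjunct1, rule_format] by simp

lemma indep_finitary: "A \<subseteq> E \<Longrightarrow> (\<And>F. F \<subseteq> A \<Longrightarrow> finite F \<Longrightarrow> indep F) \<Longrightarrow> indep A"
  using matroid[unfolded finitary_matroid_def, THEN conjunct2, THEN conjunct2, THEN conjunct2, THEN conjunct2, rule_format] by simp

lemma maximal_indep_exists:
  assumes "finite G" "indep A" "A \<subseteq> G"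
  obtains B where "indep B" "A \<subseteq> B" "B \<subseteq> G" "\<And>x. x \<in> G \<Longrightarrow> indep (insert x B) \<Longrightarrow> x \<in> B"
proof -
  let ?P = "{B. indep B \<and> A \<subseteq> B \<and> B \<subseteq> G}"
  have "finite ?P" by (rule finite_subset[of _ "Pow G"]) (use assms(1) in auto)
  moreover have "A \<in> ?P" using assms by blast
  ultimately have "\<exists>B\<in>?P. A \<subseteq> B \<and> (\<forall>X\<in>?P. B \<subseteq> X \<longrightarrow> B = X)" by (rule finite_has_maximal2)
  then obtain B where B: "B \<in> ?P" and max: "\<forall>X\<in>?P. B \<subseteq> X \<longrightarrow> B = X" by (elim bexE conjE)
  show thesis
  proof
    fix x assume "x \<in> G" "indep (insert x B)"
    then have "insert x B \<in> ?P" using B by auto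
    then have "B = insert x B" using max by blast
    then show "x \<in> B" by blast
  qed (use B in auto)
qed

lemma indep_insert_transfer:
  assumes "finite G" "indep D" "D \<subseteq> G" "\<And>y. y \<in> G \<Longrightarrow> indep (insert y D) \<Longrightarrow> y \<in> D"
    and "indep F" "F \<subseteq> G" "x \<notin> G" "indep (insert x D)"
  shows "indep (insert x F)"
proof -
  obtain B where B: "indep B" "F \<subseteq> B" "B \<subseteq> G" "\<And>y. y \<in> G \<Longrightarrow> indep (insert y B) \<Longrightarrow> y \<in> B"
    by (rule maximal_indep_exists[OF assms(1,5,6)]) blast
  have fin: "finite B" "finite D" using B(3) assms(1,3) by (auto intro: finite_subset)
  have "card B \<le> card D"
  proof (rule ccontr)
    assume "\<not> card B \<le> card D"
    then obtain y where "y \<in> B - D" "indep (insert y D)"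
      using indep_augment[OF assms(2) B(1) fin(2,1)] by auto
    then show False using assms(4) B(3) by blast
  qed
  moreover have "x \<notin> D" using assms(3,7) by blast
  ultimately have "card B < card (insert x D)" using fin by simp
  then obtain y where y: "y \<in> insert x D - B" "indep (insert y B)"
    using indep_augment[OF B(1) assms(8)] fin by auto
  have "y = x" using y B(4) assms(3) by blast
  then have "indep (insert x B)" using y(2) by simp
  then show ?thesis by (rule indep_subset) (use B(2) in blast)
qed

lemma matroid_cl_trans:
  assumes "x \<in> matroid_cl indep (matroid_cl indep A)"
  shows "x \<in> matroid_cl indep A"
proof (rule ccontr)
  assume x: "x \<notin> matroid_cl indep A"
  then obtain F where F: "F \<subseteq> matroid_cl indep A" "finite F" "indep F" "\<not> indep (insert x F)"
    using assms unfolding matroid_cl_def by blast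
  have "\<forall>f\<in>F. \<exists>D. finite D \<and> D \<subseteq> A \<and> (f \<in> D \<or> indep D \<and> \<not> indep (insert f D))"
  proof
    fix f assume "f \<in> F"
    then consider "f \<in> A" | D where "D \<subseteq> A" "finite D" "indep D" "\<not> indep (insert f D)"
      using F(1) unfolding matroid_cl_def by blast
    then show "\<exists>D. finite D \<and> D \<subseteq> A \<and> (f \<in> D \<or> indep D \<and> \<not> indep (insert f D))"
    proof cases
      case 1
      then show ?thesis by (intro exI[of _ "{f}"]) simp
    qed blast
  qed
  from bchoice[OF this] obtain supp where supp: "\<And>f. f \<in> F \<Longrightarrow> finite (supp f) \<and> supp f \<subseteq> A \<and>
      (f \<in> supp f \<or> indep (supp f) \<and> \<not> indep (insert f (supp f)))" by blast
  define G where "G = (\<Union>f\<in>F. supp f)"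
  have G: "finite G" "G \<subseteq> A" using supp F(2) unfolding G_def by auto
  obtain D where D: "indep D" "D \<subseteq> G" "\<And>y. y \<in> G \<Longrightarrow> indep (insert y D) \<Longrightarrow> y \<in> D"
    by (rule maximal_indep_exists[OF G(1) indep_empty empty_subsetI]) blast
  have dep: "f \<in> D" if "f \<in> F" "indep (insert f D)" for f
  proof (rule ccontr)
    assume f: "f \<notin> D"
    then have "f \<notin> G" using D(3) that by blast
    then have fs: "indep (supp f)" "\<not> indep (insert f (supp f))"
      using supp[OF that(1)] that(1) unfolding G_def by blast+
    have "supp f \<subseteq> G" using that(1) unfolding G_def by blast
    from indep_insert_transfer[OF G(1) D(1,2) D(3) fs(1) this \<open>f \<notin> G\<close> that(2)] fs(2)
    show False by blast
  qed
  have "finite D" using D(2) G(1) by (rule finite_subset)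
  have "x \<notin> A" using x unfolding matroid_cl_def by blast
  have xD: "indep (insert x D)"
    using x D(1,2) G(2) \<open>finite D\<close> unfolding matroid_cl_def by blast
  have "x \<notin> F" using F(3,4) by (metis insert_absorb)
  have "indep (insert x F)"
  proof (rule indep_insert_transfer)
    show "finite (G \<union> F)" using G(1) F(2) by simp
    show "D \<subseteq> G \<union> F" using D(2) by blast
    show "y \<in> D" if "y \<in> G \<union> F" "indep (insert y D)" for y using that D(3) dep by blast
    show "x \<notin> G \<union> F" using \<open>x \<notin> F\<close> \<open>x \<notin> A\<close> G(2) by blast
  qed (use D(1) F(3) xD in auto)
  then show False using F(4) by contradiction
qed

lemma finitary_closure_matroid_cl: "finitary_closure (matroid_cl indep)"
proof
  fix A B :: "'a set" and x y
  show "A \<subseteq> matroid_cl indep A" unfolding matroid_cl_def by blast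
  show "matroid_cl indep A \<subseteq> matroid_cl indep B" if "A \<subseteq> B"
    using that unfolding matroid_cl_def by blast
  show "matroid_cl indep (matroid_cl indep A) \<subseteq> matroid_cl indep A"
    using matroid_cl_trans by blast
  show "x \<in> matroid_cl indep (insert y A)"
    if "y \<in> matroid_cl indep (insert x A)" "y \<notin> matroid_cl indep A"
  proof (cases "y = x")
    case True
    then show ?thesis unfolding matroid_cl_def by blast
  next
    case False
    then have "y \<notin> insert x A" using that(2) unfolding matroid_cl_def by blast
    then have "\<exists>F\<subseteq>insert x A. finite F \<and> indep F \<and> \<not> indep (insert y F)"
      using that(1) unfolding matroid_cl_def by (elim UnE) simp_all
    then obtain F where F: "F \<subseteq> insert x A" "finite F" "indep F" "\<not> indep (insert y F)"
      by (elim exE conjE)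
    have "x \<in> F" using F that(2) unfolding matroid_cl_def by blast
    let ?G = "insert y (F - {x})"
    have "indep (F - {x})" using F(3) by (rule indep_subset) blast
    then have "indep ?G"
      using that(2) F(1,2) unfolding matroid_cl_def by blast
    moreover have "insert x ?G = insert y F" using \<open>x \<in> F\<close> by blast
    moreover have "finite ?G" "?G \<subseteq> insert y A" using F(1,2) by auto
    ultimately show ?thesis
      using F(4) unfolding matroid_cl_def by (intro UnI2 CollectI exI[of _ ?G]) (simp only: simp_thms)
  qed
  show "\<exists>F. finite F \<and> F \<subseteq> A \<and> x \<in> matroid_cl indep F" if x: "x \<in> matroid_cl indep A"
  proof (cases "x \<in> A")
    case True
    then show ?thesis unfolding matroid_cl_def by (intro exI[of _ "{x}"]) simp
  next
    case False
    then obtain F where "F \<subseteq> A" "finite F" "indep F" "\<not> indep (insert x F)"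
      using x unfolding matroid_cl_def by blast
    then show ?thesis unfolding matroid_cl_def by (intro exI[of _ F]) blast
  qed
qed

lemma matroid_cl_loop: "x \<notin> E \<Longrightarrow> x \<in> matroid_cl indep A"
  using indep_empty indep_ground[of "{x}"] unfolding matroid_cl_def by blast

lemma indep_iff_free: "indep A \<longleftrightarrow> free (matroid_cl indep) A"
proof
  assume A: "indep A"
  show "free (matroid_cl indep) A"
    unfolding free_def
  proof (intro ballI notI)
    fix x assume x: "x \<in> A" "x \<in> matroid_cl indep (A - {x})"
    then obtain F where "F \<subseteq> A - {x}" "\<not> indep (insert x F)" unfolding matroid_cl_def by blast
    moreover have "insert x F \<subseteq> A" using calculation(1) x(1) by blast
    ultimately show False using A indep_subset by blast
  qed
next
  assume A: "free (matroid_cl indep) A"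
  show "indep A"
  proof (rule indep_finitary)
    show "A \<subseteq> E" using A matroid_cl_loop unfolding free_def by blast
    fix F assume F: "F \<subseteq> A" "finite F"
    show "indep F"
      using F(2,1)
    proof (induction rule: finite_induct)
      case (insert x F)
      show ?case
      proof (rule ccontr)
        assume "\<not> indep (insert x F)"
        then have "x \<in> matroid_cl indep (A - {x})"
          using insert unfolding matroid_cl_def by blast
        then show False using A insert.prems unfolding free_def by blast
      qed
    qed (rule indep_empty)
  qed
qed

lemma contract_indep_iff:
  assumes "X \<subseteq> E"
  shows "contract_indep E indep X J \<longleftrightarrow> free (contract (matroid_cl indep) X) J"
proof -
  interpret finitary_closure "matroid_cl indep" by (rule finitary_closure_matroid_cl)
  have XE: "X \<inter> E = X" using assms by blast
  have basis: "X \<subseteq> matroid_cl indep B" if B: "basis_of indep X B" for B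
  proof
    fix x assume "x \<in> X"
    show "x \<in> matroid_cl indep B"
    proof (cases "x \<in> B")
      case True
      then show ?thesis by (rule in_cl)
    next
      case False
      then have "\<not> indep (insert x B)" using B \<open>x \<in> X\<close> unfolding basis_of_def by blast
      then show ?thesis using B free_insert indep_iff_free unfolding basis_of_def by blast
    qed
  qed
  show ?thesis
  proof
    assume "contract_indep E indep X J"
    then obtain B where J: "J \<subseteq> E - X" and B: "basis_of indep X B" and JB: "indep (J \<union> B)"
      unfolding contract_indep_def XE by blast
    have "J \<inter> B = {}" using J B unfolding basis_of_def by blast
    then have "free (contract (matroid_cl indep) B) J"
      using JB[THEN indep_iff_free[THEN iffD1]]
      by (intro free_contractI) (simp_all add: Un_commute Int_commute)
    then show "free (contract (matroid_cl indep) X) J"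
      using basis[OF B] by (rule free_contract_antimono)
  next
    assume J: "free (contract (matroid_cl indep) X) J"
    obtain B where B: "free (matroid_cl indep) B" "B \<subseteq> X" "X \<subseteq> matroid_cl indep B"
      by (rule free_extends_to_basis[OF free_empty empty_subsetI]) blast
    have "basis_of indep X B"
      unfolding basis_of_def
    proof (intro conjI ballI notI B(2))
      show "indep B" using B(1) indep_iff_free by blast
      fix x assume x: "x \<in> X - B" "indep (insert x B)"
      then have "x \<notin> matroid_cl indep (insert x B - {x})"
        using x(2)[THEN indep_iff_free[THEN iffD1]] unfolding free_def by blast
      moreover have "insert x B - {x} = B" using x(1) by blast
      ultimately show False using B(3) x(1) by auto
    qed
    moreover have "free (contract (matroid_cl indep) B) J"
      using J order_trans[OF B(2) subset_cl] by (rule free_contract_antimono)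
    then have "indep (B \<union> J)" by (rule free_Un[OF B(1), THEN indep_iff_free[THEN iffD2]])
    then have "indep (J \<union> B)" by (simp only: Un_commute)
    moreover have "J \<subseteq> E - X"
    proof
      fix x assume "x \<in> J"
      then have "x \<notin> matroid_cl indep X" by (rule free_contract_disjoint[OF J])
      then show "x \<in> E - X" using in_cl matroid_cl_loop by blast
    qed
    ultimately show "contract_indep E indep X J" unfolding contract_indep_def XE by blast
  qed
qed

lemma span_eq:
  assumes "A \<subseteq> E"
  shows "span E indep A = matroid_cl indep A \<inter> E"
proof -
  interpret finitary_closure "matroid_cl indep" by (rule finitary_closure_matroid_cl)
  have "x \<in> matroid_cl indep A" if "I \<subseteq> A" "indep I" "\<not> indep (insert x I)" for x I
    using free_insert[of I x] in_cl_mono[of x I A] that indep_iff_free by blast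
  then show ?thesis using assms unfolding span_def matroid_cl_def by blast
qed

lemma basis_of_contract:
  assumes "indep I" "basis_of (contract_indep E indep I) E' B" "E' = E - I"
  shows "free (matroid_cl indep) (I \<union> B)" "I \<inter> B = {}" "matroid_cl indep (I \<union> B) = UNIV"
proof -
  interpret finitary_closure "matroid_cl indep" by (rule finitary_closure_matroid_cl)
  interpret CI: finitary_closure "contract (matroid_cl indep) I"
    by (rule finitary_closure_contract)
  note iff = contract_indep_iff[OF indep_ground[OF assms(1)]]
  have B: "B \<subseteq> E - I" "free (contract (matroid_cl indep) I) B"
    "\<And>x. x \<in> E - I - B \<Longrightarrow> \<not> free (contract (matroid_cl indep) I) (insert x B)"
    using assms(2,3) unfolding basis_of_def iff by auto
  show "free (matroid_cl indep) (I \<union> B)"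
    using assms(1)[THEN indep_iff_free[THEN iffD1]] B(2) by (rule free_Un)
  show "I \<inter> B = {}" using B(1) by blast
  have "x \<in> matroid_cl indep (I \<union> B)" for x
  proof (cases "x \<in> E - I - B")
    case True
    then have "x \<in> contract (matroid_cl indep) I B" using B(2,3) CI.free_insert by blast
    then show ?thesis unfolding contract_def .
  next
    case False
    then show ?thesis using in_cl[of x "I \<union> B"] matroid_cl_loop by blast
  qed
  then show "matroid_cl indep (I \<union> B) = UNIV" by blast
qed

end

lemma hindered_if_obstruction:
  assumes M: "finitary_matroid E indM" and N: "finitary_matroid E indN"
    and H: "obstruction (matroid_cl indM) (matroid_cl indN) H"
  shows "hindered E indM indN"
proof -
  define cM cN where "cM = matroid_cl indM" and "cN = matroid_cl indN"
  interpret M: finitary_closure cM unfolding cM_def by (rule finitary_closure_matroid_cl[OF M])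
  interpret N: finitary_closure cN unfolding cN_def by (rule finitary_closure_matroid_cl[OF N])
  have H: "free (contract cN (- cM H)) H" "cN (- cM H \<union> H) \<noteq> UNIV"
    using H unfolding obstruction_def cM_def cN_def by auto
  have HE: "H \<subseteq> E"
  proof
    fix x assume "x \<in> H"
    then have "x \<notin> cN (- cM H)" by (rule N.free_contract_disjoint[OF H(1)])
    then show "x \<in> E" unfolding cN_def using matroid_cl_loop[OF N] by blast
  qed
  define S where "S = span E indM H"
  have S: "S = cM H \<inter> E" unfolding S_def cM_def by (rule span_eq[OF M HE])
  have outer: "E - S = - cM H" unfolding S cM_def using matroid_cl_loop[OF M] by blast
  have iff: "restrict_contract_indep E indN S J \<longleftrightarrow> free (contract cN (- cM H)) J" for J
    unfolding restrict_contract_indep_def cN_def outer[symmetric]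
    by (rule contract_indep_iff[OF N]) blast
  have "span (E \<inter> S) (restrict_contract_indep E indN S) H \<noteq> E \<inter> S"
  proof
    assume eq: "span (E \<inter> S) (restrict_contract_indep E indN S) H = E \<inter> S"
    interpret C: finitary_closure "contract cN (- cM H)" by (rule N.finitary_closure_contract)
    have "x \<in> cN (- cM H \<union> H)" for x
    proof (cases "x \<in> H \<union> - cM H \<union> - E")
      case True
      then show ?thesis
        using N.in_cl[of x "- cM H \<union> H"] matroid_cl_loop[OF N, of x] unfolding cN_def by blast
    next
      case False
      then have "x \<in> E \<inter> S" unfolding S by blast
      then have "x \<in> span (E \<inter> S) (restrict_contract_indep E indN S) H" using eq by simp
      then have "\<exists>F\<subseteq>H. restrict_contract_indep E indN S F \<and>
          \<not> restrict_contract_indep E indN S (insert x F)"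
        using False unfolding span_def by simp
      then obtain F where F: "F \<subseteq> H" "free (contract cN (- cM H)) F"
          "\<not> free (contract cN (- cM H)) (insert x F)"
        unfolding iff by (elim exE conjE)
      then have "x \<in> contract cN (- cM H) F" using C.free_insert by blast
      then show ?thesis using F(1) unfolding contract_def by (elim N.in_cl_mono) blast
    qed
    then show False using H(2) by blast
  qed
  moreover have "restrict_contract_indep E indN S H" using iff H(1) by blast
  ultimately have "hindrance E indM indN H"
    unfolding hindrance_def S_def[symmetric] by (simp add: Let_def S_def)
  then show ?thesis unfolding hindered_def by blast
qed

theorem theorem1p1:
  fixes E :: "'a set" and indM indN :: "'a set \<Rightarrow> bool" and I :: "'a set"
  assumes "finitary_matroid E indM"
    and "finitary_matroid E indN"
    and "indM I" and "indN I"
    and "rank_less (E - I) (contract_indep E indM I) (contract_indep E indN I)"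
  shows "hindered E indM indN"
proof -
  let ?cM = "matroid_cl indM" and ?cN = "matroid_cl indN"
  interpret M: finitary_closure ?cM by (rule finitary_closure_matroid_cl[OF assms(1)])
  interpret N: finitary_closure ?cN by (rule finitary_closure_matroid_cl[OF assms(2)])
  obtain T C where T: "basis_of (contract_indep E indM I) (E - I) T"
    and C: "basis_of (contract_indep E indN I) (E - I) C" and less: "|T| <o |C|"
    using assms(5) unfolding rank_less_def by blast
  note TM = basis_of_contract[OF assms(1,3) T refl]
  note CN = basis_of_contract[OF assms(2,4) C refl]
  have "\<exists>H. obstruction ?cM ?cN H"
  proof (cases "finite T")
    case True
    show ?thesis
    proof (rule obstruction_exists_finite)
      show "free ?cM I" "free ?cN I"
        using assms indep_iff_free by blast+
      fix W :: "'a set" assume W: "finite W" "card W \<le> card T"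
      show "?cN (I \<union> W) \<noteq> UNIV"
      proof
        assume "?cN (I \<union> W) = UNIV"
        moreover have "free (contract ?cN I) C" using CN(1,2) by (rule N.free_contractI)
        ultimately have "|C| \<le>o |W|"
          using finitary_closure.free_card_of_le[OF N.finitary_closure_contract, of I C W]
          unfolding contract_def by simp
        also have "|W| \<le>o |T|"
          using W True by (metis card_of_ordLeq inj_on_iff_card_le)
        finally show False using less not_ordLess_ordLeq by blast
      qed
    qed (use True TM M.finitary_closure_axioms N.finitary_closure_axioms in auto)
  next
    case False
    interpret infinite_corank ?cM ?cN I T C
      by unfold_locales (use TM CN less False in auto)
    show ?thesis by (rule obstruction_exists)
  qed
  then show ?thesis using hindered_if_obstruction assms(1,2) by blast
qed

end
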